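(* Let $k$ be a negative integer, $c>1$, and $p,q,r\ge0$ with $p+q+r=1$. Assume $0<r<p$. Then $\rho^{(k)}$ is infinitely divisible if and only if $2c^{|k|}\in\mathbb{N}$ and $$q^{2c^{|k|}}\ge c^{|k|}(r/p)^2.$$
   Context: $\mathbb{N}=\{1,2,\ldots\}$. For $k\in\mathbb{Z}$ let $\{(N_t^{(k)},L_t^{(k)}),t\ge0\}$ be the bivariate compound Poisson process (pure jump, no drift) with $E[e^{i(z_1N_t^{(k)}+z_2L_t^{(k)})}]=\exp[t\int_{\mathbb{R}^2}(e^{i(z_1x_1+z_2x_2)}-1)\nu^{(k)}(dx)]$, where $\nu^{(k)}$ is concentrated on the points $(1,0)$, $(0,1)$, $(1,c^{-k})$ with masses $u,v,w\ge0$ respectively, and $p=u/(u+v+w)$, $q=v/(u+v+w)$, $r=w/(u+v+w)$. Let $T$ be the first jump time of $\{N_t^{(k)}\}$. Define $\rho^{(k)}$ as the distribution of $L_T^{(k)}$. It depends on $u,v,w$ only through $p,q,r$. *)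

theory Defs
  imports "HOL-Probability.Probability"
begin

text \<open>The iterate \<open>(\<star>) \<nu> ^^ n\<close> applied to the Dirac measure at 0 is the \<open>n\<close>-fold
  convolution power of \<open>\<nu>\<close>.\<close>

definition infinitely_divisible :: "real measure \<Rightarrow> bool" where
  "infinitely_divisible \<mu> \<longleftrightarrow>
     real_distribution \<mu> \<and>
     (\<forall>n::nat. n \<ge> 1 \<longrightarrow>
        (\<exists>\<nu>. real_distribution \<nu> \<and> \<mu> = (convolution \<nu> ^^ n) (return borel 0)))"

definition cadlag :: "(real \<Rightarrow> 'b::topological_space) \<Rightarrow> bool" where
  "cadlag f \<longleftrightarrow>
     (\<forall>t\<ge>0. (f \<longlongrightarrow> f t) (at_right t)) \<and> (\<forall>t>0. \<exists>l. (f \<longlongrightarrow> l) (at_left t))"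

text \<open>Processes are functions on all of \<open>real\<close>; only their values at times \<open>t \<ge> 0\<close> matter.\<close>

definition levy_process :: "'a measure \<Rightarrow> (real \<Rightarrow> 'a \<Rightarrow> 'b::euclidean_space) \<Rightarrow> bool" where
  "levy_process M X \<longleftrightarrow>
     prob_space M \<and>
     (\<forall>t\<ge>0. X t \<in> borel_measurable M) \<and>
     (AE \<omega> in M. X 0 \<omega> = 0) \<and>
     (\<forall>(n::nat) (t::nat \<Rightarrow> real). 0 \<le> t 0 \<and> (\<forall>i<n. t i < t (Suc i)) \<longrightarrow>
        prob_space.indep_vars M (\<lambda>_. borel) (\<lambda>i \<omega>. X (t (Suc i)) \<omega> - X (t i) \<omega>) {..<n}) \<and>
     (\<forall>s\<ge>0. \<forall>t\<ge>0. distr M borel (\<lambda>\<omega>. X (s + t) \<omega> - X s \<omega>) = distr M borel (X t)) \<and>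
     (\<forall>t\<ge>0. \<forall>\<epsilon>>0.
        ((\<lambda>s. measure M {\<omega> \<in> space M. norm (X s \<omega> - X t \<omega>) > \<epsilon>}) \<longlongrightarrow> 0) (at t within {0..})) \<and>
     (AE \<omega> in M. cadlag (\<lambda>t. X t \<omega>))"

definition compound_poisson_process ::
  "'a measure \<Rightarrow> 'b::euclidean_space measure \<Rightarrow> (real \<Rightarrow> 'a \<Rightarrow> 'b) \<Rightarrow> bool" where
  "compound_poisson_process M \<nu> X \<longleftrightarrow>
     levy_process M X \<and>
     (\<forall>t\<ge>0. \<forall>z. (CLINT \<omega>|M. iexp (z \<bullet> X t \<omega>)) =
        exp (complex_of_real t * (CLINT x|\<nu>. iexp (z \<bullet> x) - 1)))"

definition levy_nu :: "real \<Rightarrow> int \<Rightarrow> real \<Rightarrow> real \<Rightarrow> real \<Rightarrow> (real \<times> real) measure" where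
  "levy_nu c k u v w =
     measure_of UNIV (sets borel)
       (\<lambda>A. ennreal u * indicator A (1, 0) + ennreal v * indicator A (0, 1)
          + ennreal w * indicator A (1, c powi (- k)))"

text \<open>The time of the first jump, \<open>\<infinity>\<close> if there is none.\<close>

definition first_jump_time :: "(real \<Rightarrow> real) \<Rightarrow> ereal" where
  "first_jump_time f = Inf (ereal ` {t. t > 0 \<and> f t \<noteq> Lim (at_left t) f})"

text \<open>The distribution of \<open>L\<close> at the first jump time of \<open>N\<close>.  Since paths are only almost surely
  cadlag, this random variable is determined (and measurable) only up to a null set, whence the
  completion.  On the event that \<open>N\<close> never jumps, \<open>real_of_ereal\<close> sends \<open>\<infinity>\<close> to 0; this event is
  null whenever the first coordinate has positive jump rate.\<close>

definition rho :: "'a measure \<Rightarrow> (real \<Rightarrow> 'a \<Rightarrow> real) \<Rightarrow> (real \<Rightarrow> 'a \<Rightarrow> real) \<Rightarrow> real measure" where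
  "rho M N L =
     distr (completion M) borel (\<lambda>\<omega>. L (real_of_ereal (first_jump_time (\<lambda>t. N t \<omega>))) \<omega>)"

lemma sets_levy_nu [simp]: "sets (levy_nu c k u v w) = sets borel"
  and space_levy_nu [simp]: "space (levy_nu c k u v w) = UNIV"
  using sets.sigma_sets_eq[of "borel :: (real \<times> real) measure"]
  by (simp_all add: levy_nu_def)

lemma emeasure_levy_nu:
  assumes A: "A \<in> sets borel"
  shows "emeasure (levy_nu c k u v w) A =
    ennreal u * indicator A (1, 0) + ennreal v * indicator A (0, 1)
      + ennreal w * indicator A (1, c powi (- k))"
  using levy_nu_def
proof (rule emeasure_measure_of)
  show "countably_additive (sets (levy_nu c k u v w))
     (\<lambda>A. ennreal u * indicator A (1, 0) + ennreal v * indicator A (0, 1)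
        + ennreal w * indicator A (1, c powi (- k)))"
  proof (rule countably_additiveI)
    fix F :: "nat \<Rightarrow> (real \<times> real) set"
    assume F: "disjoint_family F"
    have "(\<Sum>i. indicator (F i) x) = (indicator (\<Union> (range F)) x :: ennreal)" for x
      using suminf_indicator[OF F, of x] by simp
    then show "(\<Sum>i. ennreal u * indicator (F i) (1, 0) + ennreal v * indicator (F i) (0, 1)
        + ennreal w * indicator (F i) (1, c powi (- k)))
      = ennreal u * indicator (\<Union> (range F)) (1, 0) + ennreal v * indicator (\<Union> (range F)) (0, 1)
        + ennreal w * indicator (\<Union> (range F)) (1, c powi (- k))"
      by (simp add: suminf_add[symmetric] ennreal_suminf_cmult)
  qed
qed (use A in \<open>auto simp: positive_def\<close>)

end

theory Submission
  imports Defs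
begin

text \<open>Write \<open>b = c ^ \<bar>k\<bar>\<close>, \<open>s = r / p\<close>, \<open>z = e ^ (i t)\<close> and \<open>y = e ^ (i t b)\<close>. Observing the process at
  the first point of a grid of mesh \<open>\<delta>\<close> where \<open>N\<close> is nonzero gives a geometric series; for \<open>\<delta> \<rightarrow> 0\<close> it
  yields the characteristic function \<open>p (1 + s y) / (1 - q z)\<close> of \<open>\<rho>\<close>. As \<open>s < 1\<close>, its logarithm is that
  of a signed discrete Levy measure with mass \<open>q ^ n / n\<close> at \<open>n\<close> and \<open>- (- s) ^ m / m\<close> at \<open>b m\<close>, and
  \<open>\<rho>\<close> is infinitely divisible iff this measure is nonnegative. The atom at \<open>2 b\<close> is nonnegative
  iff \<open>Q = 2 b\<close> is an integer and \<open>q ^ Q / Q \<ge> s\<^sup>2 / 2\<close>; raising \<open>q ^ Q \<ge> b s\<^sup>2\<close> to the power \<open>i\<close>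
  shows that the atoms at \<open>2 b i\<close> are then nonnegative too.\<close>

section \<open>Cesaro means of exponentials\<close>

text \<open>The hypotheses give no jump times or marks, only characteristic functions, independent
  stationary increments and almost surely cadlag paths. Everything about \<open>T\<close> is
  therefore read off at countably many fixed times and carried over by right continuity; that
  \<open>N\<close> is integer valued, and the law of \<open>L t\<close> on \<open>N t = 0\<close>,
  must be extracted from the joint characteristic function. The signed Levy measure has atoms at
  integers and at multiples of \<open>b\<close>, and these sets may overlap. A frequency
  \<open>h\<close> outside a countable exceptional set tells a given point apart from all the
  others, so one Cesaro mean reads the total mass at that point. No uniqueness theorem for signed
  exponents is involved: the characteristic function of an \<open>n\<close>-th root of the law is
  shown to be \<open>exp (psi / n)\<close>, and letting \<open>n\<close> grow passes the sign of a
  probability on to that mass. The point \<open>2 b\<close> is the first one where the Bernoulli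
  part is negative. The factor \<open>b\<close> in the criterion is the quotient of
  \<open>1 / 2\<close> by \<open>1 / Q\<close>.\<close>

lemma iexp_add: "iexp (x + y) = iexp x * iexp y"
  by (simp add: distrib_left exp_add)

lemma iexp_of_nat_mult: "iexp (real n * x) = iexp x ^ n"
  by (simp add: exp_of_nat_mult[symmetric] mult_ac)

lemma iexp_eq_1_iff: "iexp x = 1 \<longleftrightarrow> (\<exists>n::int. x = 2 * pi * n)"
  unfolding exp_eq_1 by (auto simp: mult_ac)

text \<open>Unless \<open>iexp x = 1\<close>, the geometric sums stay bounded in \<open>m\<close>,
  and division by \<open>m\<close> kills them.\<close>

lemma cesaro_mean_iexp:
  "(\<lambda>m. (\<Sum>k<m. iexp (real k * x)) / of_nat m) \<longlonglongrightarrow> of_bool (iexp x = 1)"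
proof (cases "iexp x = 1")
  case True
  have "eventually (\<lambda>m. (\<Sum>k<m. iexp (real k * x)) / of_nat m = 1) sequentially"
    using eventually_gt_at_top[of 0]
  proof eventually_elim
    case (elim m)
    show ?case using elim True by (simp only: iexp_of_nat_mult power_one) simp
  qed
  then show ?thesis using True by (simp add: tendsto_eventually)
next
  case False
  have "norm ((\<Sum>k<m. iexp (real k * x)) / of_nat m) \<le> 2 / norm (iexp x - 1) * (1 / real m)" for m
  proof -
    have "(\<Sum>k<m. iexp (real k * x)) = (iexp x ^ m - 1) / (iexp x - 1)"
      by (simp only: iexp_of_nat_mult geometric_sum[OF False])
    moreover have "norm (iexp x ^ m - 1) \<le> 2"
      using norm_triangle_ineq4[of "iexp x ^ m" 1] by (simp add: norm_power)
    ultimately show ?thesis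
      by (simp add: norm_divide norm_mult divide_right_mono)
  qed
  then have "eventually (\<lambda>m. norm ((\<Sum>k<m. iexp (real k * x)) / of_nat m)
      \<le> 2 / norm (iexp x - 1) * (1 / real m)) sequentially"
    by (intro always_eventually allI)
  moreover have "(\<lambda>m. 2 / norm (iexp x - 1) * (1 / real m)) \<longlonglongrightarrow> 0"
    by (rule tendsto_mult_right_zero) (rule lim_1_over_n)
  ultimately have "(\<lambda>m. (\<Sum>k<m. iexp (real k * x)) / of_nat m) \<longlonglongrightarrow> 0"
    by (rule Lim_null_comparison)
  then show ?thesis using False by simp
qed

lemma norm_cesaro_mean_le:
  fixes g :: "nat \<Rightarrow> complex"
  assumes "\<And>k. norm (g k) \<le> B" "0 \<le> B"
  shows "norm ((\<Sum>k<m. g k) / of_nat m) \<le> B"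
proof (cases "m = 0")
  case False
  have "norm (\<Sum>k<m. g k) \<le> (\<Sum>k<m. B)" by (rule sum_norm_le) (rule assms)
  then show ?thesis using False by (simp add: norm_divide field_simps)
qed (use assms in auto)

text \<open>Averaging over the frequencies \<open>k h\<close>, \<open>k < m\<close>, is a discrete substitute for Fourier
  inversion: it isolates the part of \<open>f\<close> living on \<open>Y \<in> 2 \<pi> \<int>\<close>, and needs only finite sums.\<close>

lemma cesaro_mean_integral:
  fixes f :: "'a \<Rightarrow> complex" and Y :: "'a \<Rightarrow> real"
  assumes f: "integrable M f" and Y[measurable]: "Y \<in> borel_measurable M"
  shows "(\<lambda>m. (\<Sum>k<m. \<integral>x. f x * iexp (real k * Y x) \<partial>M) / of_nat m)
    \<longlonglongrightarrow> (\<integral>x. f x * of_bool (iexp (Y x) = 1) \<partial>M)"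
proof -
  note [measurable] = borel_measurable_integrable[OF f]
  have int: "integrable M (\<lambda>x. f x * iexp (real k * Y x))" for k
    by (rule Bochner_Integration.integrable_bound[OF f]) (auto simp: norm_mult)
  have eq: "(\<Sum>k<m. \<integral>x. f x * iexp (real k * Y x) \<partial>M) / of_nat m
    = (\<integral>x. f x * ((\<Sum>k<m. iexp (real k * Y x)) / of_nat m) \<partial>M)" for m
  proof -
    have "(\<Sum>k<m. \<integral>x. f x * iexp (real k * Y x) \<partial>M) = (\<integral>x. (\<Sum>k<m. f x * iexp (real k * Y x)) \<partial>M)"
      by (rule Bochner_Integration.integral_sum[symmetric]) (rule int)
    also have "(\<lambda>x. \<Sum>k<m. f x * iexp (real k * Y x)) = (\<lambda>x. f x * (\<Sum>k<m. iexp (real k * Y x)))"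
      by (simp only: sum_distrib_left)
    finally show ?thesis by (simp only: times_divide_eq_right Bochner_Integration.integral_divide_zero)
  qed
  show ?thesis unfolding eq
  proof (rule integral_dominated_convergence[where w="\<lambda>x. norm (f x)"])
    have "norm ((\<Sum>k<m. iexp (real k * Y x)) / of_nat m) \<le> 1" for m x
      by (rule norm_cesaro_mean_le) simp_all
    then show "AE x in M. norm (f x * ((\<Sum>k<m. iexp (real k * Y x)) / of_nat m)) \<le> norm (f x)" for m
      unfolding norm_mult by (intro AE_I2 mult_left_le) simp_all
    show "AE x in M. (\<lambda>m. f x * ((\<Sum>k<m. iexp (real k * Y x)) / of_nat m))
        \<longlonglongrightarrow> f x * of_bool (iexp (Y x) = 1)"
      by (intro AE_I2 tendsto_mult tendsto_const cesaro_mean_iexp)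
  qed (use f in auto)
qed

text \<open>A series is an integral over counting measure, so the integral version applies with
  \<open>f = a\<close>.\<close>

corollary cesaro_mean_suminf:
  fixes a :: "nat \<Rightarrow> complex" and y :: "nat \<Rightarrow> real"
  assumes a: "summable (\<lambda>j. norm (a j))"
  shows "(\<lambda>m. (\<Sum>k<m. \<Sum>j. a j * iexp (real k * y j)) / of_nat m)
    \<longlonglongrightarrow> (\<Sum>j. a j * of_bool (iexp (y j) = 1))"
proof -
  have [simp]: "integrable (count_space UNIV) (\<lambda>j. a j * iexp (real k * y j))" for k
    using a by (simp add: integrable_count_space_nat_iff norm_mult)
  have "summable (\<lambda>j. norm (a j * of_bool (iexp (y j) = 1)))"
    by (rule summable_comparison_test[OF _ a]) (auto simp: norm_mult)
  then have [simp]: "integrable (count_space UNIV) (\<lambda>j. a j * of_bool (iexp (y j) = 1))"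
    by (simp add: integrable_count_space_nat_iff)
  show ?thesis
    using cesaro_mean_integral[of "count_space UNIV" a y] a
    by (simp add: integrable_count_space_nat_iff integral_count_space_nat del: of_real_mult)
qed

text \<open>For each nonzero \<open>y\<close> the bad frequencies are the \<open>2 pi n / y\<close>;
  over a countable \<open>C\<close> they form a countable set, which cannot exhaust the reals. With
  such an \<open>h\<close> the periodic test \<open>iexp (h * y) = 1\<close> becomes the exact test
  \<open>y = 0\<close> on \<open>C\<close>.\<close>

lemma generic_frequency:
  assumes "countable (C :: real set)"
  obtains h where "\<And>y. y \<in> C \<Longrightarrow> y \<noteq> 0 \<Longrightarrow> iexp (h * y) \<noteq> 1"
proof -
  have "countable ((\<lambda>(y, n). 2 * pi * real_of_int n / y) ` (C \<times> UNIV))"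
    using assms by auto
  then obtain h where h: "h \<notin> (\<lambda>(y, n). 2 * pi * real_of_int n / y) ` (C \<times> UNIV)"
    using uncountable_UNIV_real by (metis UNIV_eq_I)
  show thesis
  proof (rule that, rule notI)
    fix y assume y: "y \<in> C" "y \<noteq> 0" "iexp (h * y) = 1"
    then obtain n :: int where "h * y = 2 * pi * n" using iexp_eq_1_iff by blast
    then have "h = 2 * pi * n / y" using y by (simp add: field_simps)
    then show False using h y by force
  qed
qed

section \<open>Integration against the three-atom Levy measure\<close>

lemma integral_levy_nu:
  fixes f :: "real \<times> real \<Rightarrow> complex"
  assumes [measurable]: "f \<in> borel_measurable borel" and uvw: "u \<ge> 0" "v \<ge> 0" "w \<ge> 0"
  shows "(\<integral>x. f x \<partial>levy_nu c k u v w) = u * f (1, 0) + v * f (0, 1) + w * f (1, c powi - k)"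
proof -
  \<comment> \<open>Indices instead of points: the push-forward of a point measure on
    \<open>{0, 1, 2}\<close> works even if some of the three atoms coincide.\<close>
  define P where "P = point_measure {0, 1, 2::nat} (\<lambda>i. ennreal (if i = 0 then u else if i = 1 then v else w))"
  define g :: "nat \<Rightarrow> real \<times> real" where "g i = (if i = 0 then (1, 0) else if i = 1 then (0, 1) else (1, c powi - k))" for i
  have g: "g \<in> measurable P borel"
    by (simp add: P_def measurable_def space_point_measure sets_point_measure)
  have "levy_nu c k u v w = distr P borel g"
  proof (rule measure_eqI)
    fix A assume "A \<in> sets (levy_nu c k u v w)"
    then have A: "A \<in> sets borel" by simp
    have "emeasure (distr P borel g) A = emeasure P (g -` A \<inter> {0,1,2})"
      by (subst emeasure_distr[OF g A]) (simp add: P_def space_point_measure)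
    also have "\<dots> = (\<Sum>i\<in>g -` A \<inter> {0,1,2}. ennreal (if i = 0 then u else if i = 1 then v else w))"
      unfolding P_def by (rule emeasure_point_measure_finite) auto
    also have "\<dots> = (\<Sum>i\<in>{0,1,2::nat}. ennreal (if i = 0 then u else if i = 1 then v else w) * indicator A (g i))"
      by (intro sum.mono_neutral_cong_left) (auto simp: indicator_def)
    also have "\<dots> = ennreal u * indicator A (g 0) + ennreal v * indicator A (g 1) + ennreal w * indicator A (g 2)"
      by (subst sum.insert, simp, simp)+ (simp add: add.assoc)
    also have "\<dots> = emeasure (levy_nu c k u v w) A"
      unfolding emeasure_levy_nu[OF A] by (simp add: g_def)
    finally show "emeasure (levy_nu c k u v w) A = emeasure (distr P borel g) A" by simp
  qed simp
  then have "(\<integral>x. f x \<partial>levy_nu c k u v w) = (\<integral>i. f (g i) \<partial>P)"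
    using g by (simp add: integral_distr)
  also have "\<dots> = (\<Sum>i\<in>{0,1,2::nat}. (if i = 0 then u else if i = 1 then v else w) *\<^sub>R f (g i))"
    unfolding P_def using uvw by (intro lebesgue_integral_point_measure_finite) auto
  also have "\<dots> = u * f (1, 0) + v * f (0, 1) + w * f (1, c powi - k)"
    by (simp add: g_def scaleR_conv_of_real add.assoc)
  finally show ?thesis .
qed

section \<open>Paths on a time grid\<close>

text \<open>Index \<open>j\<close> stands for the grid time \<open>(j + 1) * \<delta>\<close>, so
  time 0 is never a hit. Without any hit \<open>LEAST\<close> gives an arbitrary index; the value is
  evaluated only where a hit exists.\<close>

definition grid_hit :: "(real \<Rightarrow> real) \<Rightarrow> real \<Rightarrow> nat" where
  "grid_hit f \<delta> = (LEAST j. f (real (Suc j) * \<delta>) \<noteq> 0)"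

definition grid_hit_time :: "(real \<Rightarrow> real) \<Rightarrow> real \<Rightarrow> real" where
  "grid_hit_time f \<delta> = real (Suc (grid_hit f \<delta>)) * \<delta>"

text \<open>Integrality is assumed only at rational grid times because almost sure statements
  survive only countable intersections. The nonintegers form an open set, so a noninteger value
  would persist just to the right, where there are grid points. Integers closer than 1 coincide,
  whence local constancy.\<close>

lemma right_continuous_int_path:
  fixes f :: "real \<Rightarrow> real"
  assumes rc: "\<And>t. t \<ge> 0 \<Longrightarrow> (f \<longlongrightarrow> f t) (at_right t)"
    and grid: "\<And>i n. f (real i / real (Suc n)) \<in> \<int>"
    and t: "t \<ge> 0"
  shows "f t \<in> \<int>" "\<exists>b>t. \<forall>s. t \<le> s \<and> s < b \<longrightarrow> f s = f t"
proof -
  have int: "f t \<in> \<int>" if t: "t \<ge> 0" for t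
  proof (rule ccontr)
    assume "f t \<notin> \<int>"
    then have "eventually (\<lambda>s. f s \<in> - \<int>) (at_right t)"
      using rc[OF t] by (intro topological_tendstoD) (auto simp: open_Compl)
    then obtain b where b: "b > t" "\<And>s. t < s \<Longrightarrow> s < b \<Longrightarrow> f s \<notin> \<int>"
      by (auto simp: eventually_at_right_field)
    obtain n where n: "1 / real (Suc n) < b - t"
      using b(1) reals_Archimedean[of "b - t"] by (auto simp: inverse_eq_divide)
    define r where "r = real (Suc n)"
    \<comment> \<open>The first grid index strictly to the right of \<open>t\<close>: the right
      limit constrains only later times.\<close>
    define i where "i = nat \<lfloor>t * r\<rfloor> + 1"
    have r: "r > 0" by (simp add: r_def)
    then have "real i \<le> t * r + 1" "t * r < real i"
      using t unfolding i_def by (simp_all, linarith)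
    then have "t < real i / r" "real i / r \<le> t + 1 / r"
      using r by (simp_all add: field_simps)
    then have "t < real i / real (Suc n)" "real i / real (Suc n) \<le> t + 1 / real (Suc n)"
      unfolding r_def .
    then show False using b(2)[of "real i / real (Suc n)"] grid[of i n] n by auto
  qed
  then show "f t \<in> \<int>" using t .
  have "eventually (\<lambda>s. dist (f s) (f t) < 1) (at_right t)"
    using rc[OF t] by (rule tendstoD) simp
  then obtain b where b: "b > t" "\<And>s. t < s \<Longrightarrow> s < b \<Longrightarrow> dist (f s) (f t) < 1"
    by (auto simp: eventually_at_right_field)
  have "f s = f t" if "t \<le> s" "s < b" for s
  proof (cases "s = t")
    case False
    then have "\<bar>f s - f t\<bar> < 1" "f s - f t \<in> \<int>"
      using b(2)[of s] that int[of s] int[OF t] t by (auto simp: dist_real_def)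
    then show ?thesis using Ints_nonzero_abs_less1 by force
  qed simp
  then show "\<exists>b>t. \<forall>s. t \<le> s \<and> s < b \<longrightarrow> f s = f t" using b(1) by blast
qed

text \<open>The infimum \<open>\<tau>\<close> of the times with nonzero value is the first jump: the
  path vanishes before \<open>\<tau>\<close>, so all left limits up to \<open>\<tau>\<close> are 0,
  and local constancy makes \<open>f \<tau>\<close> nonzero. Later returns to 0 do no harm, since a
  fine grid has a point in the interval right of \<open>\<tau>\<close> on which \<open>f\<close>
  keeps its value.\<close>

lemma grid_hit_time_tendsto_first_jump_time:
  fixes f :: "real \<Rightarrow> real"
  assumes rc: "\<And>t. t \<ge> 0 \<Longrightarrow> (f \<longlongrightarrow> f t) (at_right t)"
    and grid: "\<And>i n. f (real i / real (Suc n)) \<in> \<int>"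
    and f0: "f 0 = 0"
    and hit: "\<And>n. \<exists>j. f (real (Suc j) * (1 / real (Suc n))) \<noteq> 0"
  obtains \<tau> where "first_jump_time f = ereal \<tau>" "\<tau> > 0"
    "\<And>n. grid_hit_time f (1 / real (Suc n)) \<ge> \<tau>"
    "(\<lambda>n. grid_hit_time f (1 / real (Suc n))) \<longlonglongrightarrow> \<tau>"
proof -
  define S where "S = {t. t \<ge> 0 \<and> f t \<noteq> 0}"
  define \<tau> where "\<tau> = Inf S"
  have bdd: "bdd_below S" by (auto simp: S_def bdd_below_def)
  obtain j0 where "f (real (Suc j0) * (1 / real (Suc 0))) \<noteq> 0" using hit by blast
  then have ne: "S \<noteq> {}" by (auto simp: S_def intro: exI[of _ "real (Suc j0)"])
  have \<tau>0: "\<tau> \<ge> 0" unfolding \<tau>_def by (rule cInf_greatest[OF ne]) (auto simp: S_def)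
  have below: "f s = 0" if "0 \<le> s" "s < \<tau>" for s
  proof (rule ccontr)
    assume "f s \<noteq> 0"
    then have "s \<in> S" using that by (simp add: S_def)
    then have "\<tau> \<le> s" unfolding \<tau>_def by (rule cInf_lower[OF _ bdd])
    then show False using that by simp
  qed
  obtain b where b: "b > \<tau>" "\<And>s. \<tau> \<le> s \<Longrightarrow> s < b \<Longrightarrow> f s = f \<tau>"
    using right_continuous_int_path(2)[of f \<tau>, OF _ grid \<tau>0] rc by blast
  have f\<tau>: "f \<tau> \<noteq> 0"
  proof
    assume "f \<tau> = 0"
    then have z: "f s = 0" if "0 \<le> s" "s < b" for s
      using that below b(2)[of s] by (cases "s < \<tau>") auto
    have "b \<le> \<tau>" unfolding \<tau>_def
    proof (rule cInf_greatest[OF ne])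
      fix s assume "s \<in> S" then show "b \<le> s" using z[of s] by (cases "s < b") (auto simp: S_def)
    qed
    then show False using b(1) by simp
  qed
  then have \<tau>: "\<tau> > 0" using f0 \<tau>0 by (cases "\<tau> = 0") auto
  have Lim0: "Lim (at_left t) f = 0" if "0 < t" "t \<le> \<tau>" for t
  proof (rule tendsto_Lim)
    have "eventually (\<lambda>s. s \<in> {0<..<t}) (at_left t)"
      using that by (intro eventually_at_leftI[of 0]) auto
    then have "eventually (\<lambda>s. f s = 0) (at_left t)"
      by eventually_elim (use that below in auto)
    then show "(f \<longlongrightarrow> 0) (at_left t)" by (rule tendsto_eventually)
  qed simp
  have "first_jump_time f = ereal \<tau>"
    unfolding first_jump_time_def
  proof (rule Inf_eqI)
    fix i assume "i \<in> ereal ` {t. 0 < t \<and> f t \<noteq> Lim (at_left t) f}"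
    then obtain t where t: "i = ereal t" "0 < t" "f t \<noteq> Lim (at_left t) f" by auto
    have "\<not> t < \<tau>" using t Lim0[of t] below[of t] by auto
    then show "ereal \<tau> \<le> i" using t by simp
  next
    fix y assume "\<And>i. i \<in> ereal ` {t. 0 < t \<and> f t \<noteq> Lim (at_left t) f} \<Longrightarrow> y \<le> i"
    then show "y \<le> ereal \<tau>" using \<tau> f\<tau> Lim0[of \<tau>] by auto
  qed
  moreover note \<tau>
  moreover have nz: "f (grid_hit_time f (1 / real (Suc n))) \<noteq> 0" for n
    unfolding grid_hit_time_def grid_hit_def using hit[of n] by (rule LeastI_ex)
  have ge: "grid_hit_time f (1 / real (Suc n)) \<ge> \<tau>" for n
    using nz[of n] below[of "grid_hit_time f (1 / real (Suc n))"]
    by (cases "grid_hit_time f (1 / real (Suc n)) < \<tau>") (auto simp: grid_hit_time_def)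
  moreover
  have ub: "grid_hit_time f (1 / real (Suc n)) \<le> \<tau> + 1 / real (Suc n)" if n: "1 / real (Suc n) < b - \<tau>" for n
  proof -
    define r where "r = real (Suc n)"
    \<comment> \<open>\<open>Suc m\<close> is the first grid index not below
      \<open>\<tau> * r\<close>; the shift by 1 matches \<open>grid_hit\<close>, and
      \<open>\<tau> > 0\<close> keeps \<open>nat\<close> from truncating.\<close>
    define m where "m = nat (\<lceil>\<tau> * r\<rceil> - 1)"
    have r: "r > 0" by (simp add: r_def)
    then have "\<lceil>\<tau> * r\<rceil> > 0" using \<tau> by simp
    then have m: "real (Suc m) = of_int \<lceil>\<tau> * r\<rceil>"
      unfolding m_def by simp
    have "\<tau> * r \<le> real (Suc m)" "real (Suc m) \<le> \<tau> * r + 1"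
      unfolding m by linarith+
    then have "\<tau> \<le> real (Suc m) * (1 / r)" "real (Suc m) * (1 / r) \<le> \<tau> + 1 / r"
      using r by (simp_all add: field_simps)
    then have le: "\<tau> \<le> real (Suc m) * (1 / real (Suc n))" "real (Suc m) * (1 / real (Suc n)) \<le> \<tau> + 1 / real (Suc n)"
      unfolding r_def .
    then have "f (real (Suc m) * (1 / real (Suc n))) \<noteq> 0"
      using b(2)[of "real (Suc m) * (1 / real (Suc n))"] n f\<tau> by auto
    then have "grid_hit f (1 / real (Suc n)) \<le> m"
      unfolding grid_hit_def by (rule Least_le)
    then have "real (Suc (grid_hit f (1 / real (Suc n)))) * (1 / real (Suc n)) \<le> real (Suc m) * (1 / real (Suc n))"
      by (intro mult_right_mono) auto
    then show ?thesis using le(2) unfolding grid_hit_time_def by linarith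
  qed
  have "(\<lambda>n. grid_hit_time f (1 / real (Suc n))) \<longlonglongrightarrow> \<tau>"
  proof (rule tendsto_sandwich[of "\<lambda>_. \<tau>" _ _ "\<lambda>n. \<tau> + 1 / real (Suc n)"])
    have lim: "(\<lambda>n. 1 / real (Suc n)) \<longlonglongrightarrow> 0" using LIMSEQ_inverse_real_of_nat by (simp add: inverse_eq_divide)
    then have "eventually (\<lambda>n. 1 / real (Suc n) < b - \<tau>) sequentially"
      by (rule order_tendstoD) (use b(1) in simp)
    then show "eventually (\<lambda>n. grid_hit_time f (1 / real (Suc n)) \<le> \<tau> + 1 / real (Suc n)) sequentially"
      by eventually_elim (rule ub)
    show "(\<lambda>n. \<tau> + 1 / real (Suc n)) \<longlonglongrightarrow> \<tau>"
      using tendsto_add[OF tendsto_const lim] by simp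
  qed (use ge in auto)
  ultimately show thesis using that by blast
qed

text \<open>The filter \<open>at_right t\<close> leaves out \<open>t\<close>, which the sequence may
  attain; hence the passage to limits within \<open>{t..}\<close>.\<close>

lemma right_continuous_sequentially:
  fixes l :: "real \<Rightarrow> real"
  assumes "(l \<longlongrightarrow> l t) (at_right t)" "\<And>n. s n \<ge> t" "s \<longlonglongrightarrow> t"
  shows "(\<lambda>n. l (s n)) \<longlonglongrightarrow> l t"
proof -
  have "continuous (at t within {t..}) l"
    using assms(1) by (simp add: continuous_within at_within_Ici_at_right)
  then show ?thesis
    using assms(2,3) unfolding continuous_within_sequentially by (auto simp: comp_def)
qed

text \<open>Allows \<open>rho\<close>, defined on the completion, to be computed from a version
  measurable for \<open>M\<close>: changing \<open>g\<close> on a null set alters preimages by null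
  sets only.\<close>

lemma distr_completion_AE_eq:
  fixes f g :: "'a \<Rightarrow> real"
  assumes g[measurable]: "g \<in> borel_measurable M" and ae: "AE x in M. f x = g x"
  shows "distr (completion M) borel f = distr M borel g"
proof -
  have ae': "AE x in completion M. g x = f x" using AE_completion[OF ae] by eventually_elim simp
  have f: "f \<in> borel_measurable (completion M)"
  proof (rule measurableI)
    fix A :: "real set" assume [measurable]: "A \<in> sets borel"
    have "g -` A \<inter> space M \<in> sets (completion M)" by auto
    then show "f -` A \<inter> space (completion M) \<in> sets (completion M)"
    proof (rule completion.in_sets_AE[rotated])
      show "AE x in completion M. x \<in> g -` A \<inter> space M \<longleftrightarrow> x \<in> f -` A \<inter> space (completion M)"
        using ae' by eventually_elim auto
    qed auto
  qed simp
  have "distr (completion M) borel f = distr (completion M) borel g"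
  proof (rule distr_cong_AE)
    show "AE x in completion M. f x = g x" using ae' by eventually_elim simp
  qed (use f g in \<open>auto intro: measurable_completion\<close>)
  also have "\<dots> = distr M borel g"
  proof (rule measure_eqI)
    fix A :: "real set" assume "A \<in> sets (distr (completion M) borel g)"
    then have [measurable]: "A \<in> sets borel" by simp
    show "emeasure (distr (completion M) borel g) A = emeasure (distr M borel g) A"
      by (simp add: emeasure_distr measurable_completion main_part_sets)
  qed simp
  finally show ?thesis .
qed

section \<open>The law of \<open>L\<close> at the first jump of \<open>N\<close>\<close>

text \<open>\<open>b\<close> is the second coordinate of the third atom, and the exponent in
  \<open>cf\<close> is the integral over the three atoms. Positivity of the jump rate
  \<open>u + w\<close> of \<open>N\<close> makes the first jump time almost surely finite.\<close>

locale marked_poisson = prob_space M for M :: "'a measure" +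
  fixes N L :: "real \<Rightarrow> 'a \<Rightarrow> real" and u v w b :: real
  assumes levy: "levy_process M (\<lambda>t \<omega>. (N t \<omega>, L t \<omega>))"
    and cf: "\<And>t x y. t \<ge> 0 \<Longrightarrow> (CLINT \<omega>|M. iexp (x * N t \<omega> + y * L t \<omega>)) =
      exp (complex_of_real t * (u * (iexp x - 1) + v * (iexp y - 1) + w * (iexp (x + y * b) - 1)))"
    and rates: "u \<ge> 0" "v \<ge> 0" "w \<ge> 0" "u + w > 0"
begin

lemma pair_measurable: "t \<ge> 0 \<Longrightarrow> (\<lambda>\<omega>. (N t \<omega>, L t \<omega>)) \<in> borel_measurable M"
  using levy unfolding levy_process_def by blast

lemma N_measurable [measurable (raw)]: "t \<ge> 0 \<Longrightarrow> N t \<in> borel_measurable M"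
  using measurable_comp[OF pair_measurable, of t fst borel] by (simp add: comp_def borel_prod[symmetric])

lemma L_measurable [measurable (raw)]: "t \<ge> 0 \<Longrightarrow> L t \<in> borel_measurable M"
  using measurable_comp[OF pair_measurable, of t snd borel] by (simp add: comp_def borel_prod[symmetric])

lemma AE_start: "AE \<omega> in M. N 0 \<omega> = 0 \<and> L 0 \<omega> = 0"
  using levy unfolding levy_process_def by (simp add: zero_prod_def)

lemma AE_right_continuous:
  "AE \<omega> in M. \<forall>t\<ge>0. ((\<lambda>s. N s \<omega>) \<longlongrightarrow> N t \<omega>) (at_right t) \<and> ((\<lambda>s. L s \<omega>) \<longlongrightarrow> L t \<omega>) (at_right t)"
proof -
  have "AE \<omega> in M. cadlag (\<lambda>t. (N t \<omega>, L t \<omega>))"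
    using levy unfolding levy_process_def by blast
  then show ?thesis
  proof eventually_elim
    case (elim \<omega>)
    show ?case
    proof (intro allI impI)
      fix t :: real assume "t \<ge> 0"
      then have "((\<lambda>s. (N s \<omega>, L s \<omega>)) \<longlongrightarrow> (N t \<omega>, L t \<omega>)) (at_right t)"
        using elim unfolding cadlag_def by blast
      from tendsto_fst[OF this] tendsto_snd[OF this]
      show "((\<lambda>s. N s \<omega>) \<longlongrightarrow> N t \<omega>) (at_right t) \<and> ((\<lambda>s. L s \<omega>) \<longlongrightarrow> L t \<omega>) (at_right t)"
        by simp
    qed
  qed
qed

text \<open>At frequency \<open>2 pi\<close> for \<open>N\<close> and 0 for \<open>L\<close> the
  exponent vanishes, so \<open>cos (2 pi N)\<close> has mean 1 without ever exceeding 1.\<close>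

lemma AE_N_int:
  assumes t: "t \<ge> 0" shows "AE \<omega> in M. N t \<omega> \<in> \<int>"
proof -
  note [measurable] = N_measurable[OF t]
  have iexp_2pi: "iexp (2 * pi) = 1"
    unfolding iexp_eq_1_iff by (rule exI[of _ 1]) simp
  have "(CLINT \<omega>|M. iexp (2 * pi * N t \<omega> + 0 * L t \<omega>)) = 1"
    unfolding cf[OF t] using iexp_2pi by (simp del: of_real_mult)
  then have 1: "(CLINT \<omega>|M. iexp (2 * pi * N t \<omega>)) = 1" by simp
  have int: "integrable M (\<lambda>\<omega>. iexp (2 * pi * N t \<omega>))"
    by (rule integrable_const_bound[of _ 1]) auto
  have "(\<integral>\<omega>. cos (2 * pi * N t \<omega>) \<partial>M) = Re (CLINT \<omega>|M. iexp (2 * pi * N t \<omega>))"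
    unfolding integral_Re[OF int, symmetric] by (simp add: Re_exp)
  then have c: "(\<integral>\<omega>. cos (2 * pi * N t \<omega>) \<partial>M) = 1" using 1 by simp
  have ic: "integrable M (\<lambda>\<omega>. cos (2 * pi * N t \<omega>))"
    by (rule integrable_const_bound[of _ 1]) auto
  have "(\<integral>\<omega>. 1 - cos (2 * pi * N t \<omega>) \<partial>M) = 0"
    using ic c by (subst Bochner_Integration.integral_diff) (auto simp: prob_space)
  then have "AE \<omega> in M. 1 - cos (2 * pi * N t \<omega>) = 0"
    by (subst (asm) integral_nonneg_eq_0_iff_AE) (use ic in auto)
  then show ?thesis
  proof eventually_elim
    case (elim \<omega>)
    then have "cos (2 * pi * N t \<omega>) = 1" by simp
    then obtain n :: int where "2 * pi * N t \<omega> = of_int n * 2 * pi"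
      using cos_one_2pi_int by blast
    then have "N t \<omega> = of_int n" by simp
    then show ?case by simp
  qed
qed

text \<open>The expectation of \<open>iexp (y * L t)\<close> on the event \<open>N t = 0\<close>:
  only the \<open>(0, 1)\<close> jumps remain, with killing at rate \<open>u + w\<close>.\<close>

definition cf_nojump :: "real \<Rightarrow> real \<Rightarrow> complex" where
  "cf_nojump t y = exp (complex_of_real t * (v * (iexp y - 1) - u - w))"

definition cf_L :: "real \<Rightarrow> real \<Rightarrow> complex" where
  "cf_L t y = exp (complex_of_real t * (v * (iexp y - 1) + w * (iexp (y * b) - 1)))"

lemma expectation_cf_L:
  assumes t: "t \<ge> 0" shows "(CLINT \<omega>|M. iexp (y * L t \<omega>)) = cf_L t y"
  using cf[OF t, of 0 y] by (simp add: cf_L_def)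

text \<open>The Cesaro mean over \<open>x = k h\<close> extracts the coefficient of \<open>iexp x ^ 0\<close> from the joint
  characteristic function.\<close>

lemma expectation_cf_nojump:
  assumes t: "t \<ge> 0"
  shows "(CLINT \<omega>|M. iexp (y * L t \<omega>) * of_bool (N t \<omega> = 0)) = cf_nojump t y"
proof -
  note [measurable] = N_measurable[OF t] L_measurable[OF t]
  obtain h where h: "\<And>x. x \<in> \<int> \<Longrightarrow> x \<noteq> 0 \<Longrightarrow> iexp (h * x) \<noteq> 1"
    using generic_frequency[of "\<int>"] by (auto simp: Ints_def)
  \<comment> \<open>Once the factor free of \<open>x\<close> is split off, the rest of the
    characteristic function is \<open>exp (B * iexp x)\<close> with
    \<open>B = t (u + w iexp (y b))\<close>; the \<open>j\<close>-th term of its power series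
    belongs to \<open>N t = j\<close>.\<close>
  define a where "a j = cf_nojump t y * ((complex_of_real t * (u + w * iexp (y * b))) ^ j /\<^sub>R fact j)" for j
  have sa: "summable (\<lambda>j. norm (a j))"
    unfolding a_def norm_mult by (intro summable_mult summable_norm_exp)
  have series: "(CLINT \<omega>|M. iexp (y * L t \<omega>) * iexp (real k * (h * N t \<omega>)))
    = (\<Sum>j. a j * iexp (real k * (real j * h)))" for k
  proof -
    define z where "z = iexp (real k * h)"
    define B where "B = complex_of_real t * (u + w * iexp (y * b))"
    have "(CLINT \<omega>|M. iexp (y * L t \<omega>) * iexp (real k * (h * N t \<omega>)))
      = (CLINT \<omega>|M. iexp ((real k * h) * N t \<omega> + y * L t \<omega>))"
      unfolding iexp_add by (simp add: mult_ac)
    also have "\<dots> = exp (complex_of_real t * (u * (z - 1) + v * (iexp y - 1) + w * (z * iexp (y * b) - 1)))"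
      unfolding cf[OF t] z_def by (simp only: iexp_add)
    also have "\<dots> = cf_nojump t y * exp (B * z)"
      unfolding cf_nojump_def B_def exp_add[symmetric] by (rule arg_cong[of _ _ exp]) (simp add: algebra_simps)
    also have "exp (B * z) = (\<Sum>j. (B * z) ^ j /\<^sub>R fact j)"
      by (simp add: exp_def)
    also have "cf_nojump t y * \<dots> = (\<Sum>j. cf_nojump t y * ((B * z) ^ j /\<^sub>R fact j))"
      by (rule suminf_mult[symmetric]) (rule summable_exp_generic)
    also have "(\<lambda>j. cf_nojump t y * ((B * z) ^ j /\<^sub>R fact j)) = (\<lambda>j. a j * iexp (real k * (real j * h)))"
    proof
      fix j
      have "z ^ j = iexp (real k * (real j * h))"
        unfolding z_def iexp_of_nat_mult[symmetric] by (simp add: mult_ac)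
      then show "cf_nojump t y * ((B * z) ^ j /\<^sub>R fact j) = a j * iexp (real k * (real j * h))"
        unfolding a_def B_def[symmetric] by (simp add: power_mult_distrib)
    qed
    finally show ?thesis .
  qed
  have "(\<lambda>m. (\<Sum>k<m. CLINT \<omega>|M. iexp (y * L t \<omega>) * iexp (real k * (h * N t \<omega>))) / of_nat m)
    \<longlonglongrightarrow> (CLINT \<omega>|M. iexp (y * L t \<omega>) * of_bool (iexp (h * N t \<omega>) = 1))"
    by (rule cesaro_mean_integral) (auto intro!: integrable_const_bound[of _ 1])
  moreover have "(\<lambda>m. (\<Sum>k<m. CLINT \<omega>|M. iexp (y * L t \<omega>) * iexp (real k * (h * N t \<omega>))) / of_nat m)
    \<longlonglongrightarrow> (\<Sum>j. a j * of_bool (iexp (real j * h) = 1))"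
    unfolding series by (rule cesaro_mean_suminf[OF sa])
  ultimately have "(CLINT \<omega>|M. iexp (y * L t \<omega>) * of_bool (iexp (h * N t \<omega>) = 1))
    = (\<Sum>j. a j * of_bool (iexp (real j * h) = 1))"
    by (rule LIMSEQ_unique)
  also have "(\<Sum>j. a j * of_bool (iexp (real j * h) = 1)) = (\<Sum>j\<in>{0}. a j * of_bool (iexp (real j * h) = 1))"
  proof (rule suminf_finite)
    fix j :: nat assume "j \<notin> {0}"
    then have "iexp (real j * h) \<noteq> 1" using h[of "real j"] by (simp add: mult.commute)
    then show "a j * of_bool (iexp (real j * h) = 1) = 0" by simp
  qed simp
  also have "\<dots> = cf_nojump t y" by (simp add: a_def)
  also have "(CLINT \<omega>|M. iexp (y * L t \<omega>) * of_bool (iexp (h * N t \<omega>) = 1))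
    = (CLINT \<omega>|M. iexp (y * L t \<omega>) * of_bool (N t \<omega> = 0))"
  proof (rule integral_cong_AE)
    show "AE \<omega> in M. iexp (y * L t \<omega>) * of_bool (iexp (h * N t \<omega>) = 1) = iexp (y * L t \<omega>) * of_bool (N t \<omega> = 0)"
      using AE_N_int[OF t]
    proof eventually_elim
      case (elim \<omega>)
      show ?case using h[OF elim] by (cases "N t \<omega> = 0") auto
    qed
  qed auto
  finally show ?thesis .
qed


section \<open>First nonzero grid point via independent increments\<close>

definition first_hit :: "real \<Rightarrow> nat \<Rightarrow> 'a \<Rightarrow> bool" where
  "first_hit \<delta> j \<omega> \<longleftrightarrow> (\<forall>i\<le>j. N (real i * \<delta>) \<omega> = 0) \<and> N (real (Suc j) * \<delta>) \<omega> \<noteq> 0"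

lemma first_hit_unique: "first_hit \<delta> i \<omega> \<Longrightarrow> first_hit \<delta> j \<omega> \<Longrightarrow> i = j"
  unfolding first_hit_def by (metis linorder_neqE_nat Suc_leI)

lemma first_hit_measurable [measurable]:
  assumes "\<delta> > 0" shows "Measurable.pred M (first_hit \<delta> j)"
proof -
  have [measurable]: "N (real i * \<delta>) \<in> borel_measurable M" for i using assms by (intro N_measurable) simp
  show ?thesis unfolding first_hit_def by measurable
qed

lemma first_hit_grid_hit:
  assumes "first_hit \<delta> j \<omega>" shows "grid_hit (\<lambda>t. N t \<omega>) \<delta> = j"
  unfolding grid_hit_def
proof (rule Least_equality)
  fix i assume "N (real (Suc i) * \<delta>) \<omega> \<noteq> 0"
  then show "j \<le> i" using assms unfolding first_hit_def by (metis not_less_eq_eq)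
qed (use assms in \<open>simp add: first_hit_def\<close>)

definition increment :: "real \<Rightarrow> nat \<Rightarrow> 'a \<Rightarrow> real \<times> real" where
  "increment \<delta> i \<omega> = (N (real (Suc i) * \<delta>) \<omega>, L (real (Suc i) * \<delta>) \<omega>) - (N (real i * \<delta>) \<omega>, L (real i * \<delta>) \<omega>)"

lemma indep_increments:
  assumes "\<delta> > 0" shows "indep_vars (\<lambda>_. borel) (increment \<delta>) {..<n}"
proof -
  have "\<forall>(n::nat) (t::nat \<Rightarrow> real). 0 \<le> t 0 \<and> (\<forall>i<n. t i < t (Suc i)) \<longrightarrow>
        indep_vars (\<lambda>_. borel) (\<lambda>i \<omega>. (N (t (Suc i)) \<omega>, L (t (Suc i)) \<omega>) - (N (t i) \<omega>, L (t i) \<omega>)) {..<n}"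
    using levy unfolding levy_process_def by blast
  from this[rule_format, of "\<lambda>i. real i * \<delta>" n] show ?thesis
    using assms by (simp add: increment_def[abs_def])
qed

lemma increment_measurable [measurable]:
  assumes "\<delta> > 0" shows "increment \<delta> i \<in> borel_measurable M"
  unfolding increment_def[abs_def] using assms
  by (intro borel_measurable_diff pair_measurable) simp_all

lemma distr_increment:
  assumes "\<delta> > 0" shows "distr M borel (increment \<delta> i) = distr M borel (\<lambda>\<omega>. (N \<delta> \<omega>, L \<delta> \<omega>))"
proof -
  have "\<forall>s\<ge>0. \<forall>t\<ge>0. distr M borel (\<lambda>\<omega>. (N (s + t) \<omega>, L (s + t) \<omega>) - (N s \<omega>, L s \<omega>)) = distr M borel (\<lambda>\<omega>. (N t \<omega>, L t \<omega>))"
    using levy unfolding levy_process_def by blast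
  from this[rule_format, of "real i * \<delta>" \<delta>] show ?thesis
    using assms by (simp add: increment_def[abs_def] algebra_simps)
qed

lemma integral_increment:
  fixes g :: "real \<times> real \<Rightarrow> complex"
  assumes \<delta>: "\<delta> > 0" and [measurable]: "g \<in> borel_measurable borel"
  shows "(\<integral>\<omega>. g (increment \<delta> i \<omega>) \<partial>M) = (\<integral>\<omega>. g (N \<delta> \<omega>, L \<delta> \<omega>) \<partial>M)"
proof -
  have "(\<integral>\<omega>. g (increment \<delta> i \<omega>) \<partial>M) = (\<integral>x. g x \<partial>distr M borel (increment \<delta> i))"
    by (rule integral_distr[symmetric]) (use \<delta> in auto)
  also have "\<dots> = (\<integral>\<omega>. g (N \<delta> \<omega>, L \<delta> \<omega>) \<partial>M)"
    unfolding distr_increment[OF \<delta>]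
    by (rule integral_distr) (use \<delta> in \<open>auto intro: pair_measurable\<close>)
  finally show ?thesis .
qed

lemma sum_increments:
  assumes "N 0 \<omega> = 0" "L 0 \<omega> = 0"
  shows "(N (real n * \<delta>) \<omega>, L (real n * \<delta>) \<omega>) = (\<Sum>i<n. increment \<delta> i \<omega>)"
proof -
  have "(\<Sum>i<n. increment \<delta> i \<omega>) = (N (real n * \<delta>) \<omega>, L (real n * \<delta>) \<omega>) - (N (real 0 * \<delta>) \<omega>, L (real 0 * \<delta>) \<omega>)"
    unfolding increment_def by (rule sum_lessThan_telescope)
  then show ?thesis using assms by simp
qed

text \<open>By telescoping from 0, vanishing of \<open>N\<close> at the grid points 0 to
  \<open>j\<close> amounts to vanishing of its first \<open>j\<close> increments. In this form the
  indicator is a product over independent increments.\<close>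

lemma first_hit_iff_increments:
  assumes "N 0 \<omega> = 0" "L 0 \<omega> = 0"
  shows "first_hit \<delta> j \<omega> \<longleftrightarrow> (\<forall>i<j. fst (increment \<delta> i \<omega>) = 0) \<and> fst (increment \<delta> j \<omega>) \<noteq> 0"
proof -
  have "(\<forall>i\<le>j. N (real i * \<delta>) \<omega> = 0) \<longleftrightarrow> (\<forall>i<j. fst (increment \<delta> i \<omega>) = 0)"
  proof (intro iffI allI impI)
    fix i assume "\<forall>i<j. fst (increment \<delta> i \<omega>) = 0" "i \<le> j"
    then have "fst (\<Sum>i<i. increment \<delta> i \<omega>) = 0"
      unfolding fst_sum by (intro sum.neutral) auto
    then show "N (real i * \<delta>) \<omega> = 0"
      unfolding sum_increments[OF assms, symmetric] by simp
  next
    fix i assume "\<forall>i\<le>j. N (real i * \<delta>) \<omega> = 0" "i < j"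
    then have "N (real i * \<delta>) \<omega> = 0" "N (real (Suc i) * \<delta>) \<omega> = 0" by (blast intro: less_imp_le Suc_leI)+
    then show "fst (increment \<delta> i \<omega>) = 0" by (simp add: increment_def)
  qed
  moreover have "fst (increment \<delta> j \<omega>) = N (real (Suc j) * \<delta>) \<omega> - N (real j * \<delta>) \<omega>"
    by (simp add: increment_def)
  ultimately show ?thesis unfolding first_hit_def by auto
qed

text \<open>Both the exponential and the indicator factor over \<open>j + 1\<close> independent
  increments: the first \<open>j\<close> leave \<open>N\<close> unchanged and contribute
  \<open>cf_nojump\<close> each, the last one changes \<open>N\<close> and contributes
  \<open>cf_L\<close> minus that.\<close>

lemma expectation_first_hit:
  assumes \<delta>: "\<delta> > 0"
  shows "(CLINT \<omega>|M. iexp (y * L (real (Suc j) * \<delta>) \<omega>) * of_bool (first_hit \<delta> j \<omega>))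
    = cf_nojump \<delta> y ^ j * (cf_L \<delta> y - cf_nojump \<delta> y)"
proof -
  note [measurable] = N_measurable[OF less_imp_le[OF \<delta>]] L_measurable[OF less_imp_le[OF \<delta>]] increment_measurable[OF \<delta>]
  define F :: "nat \<Rightarrow> real \<times> real \<Rightarrow> complex"
    where "F i = (\<lambda>x. iexp (y * snd x) * of_bool (if i < j then fst x = 0 else fst x \<noteq> 0))" for i
  have [measurable]: "fst \<in> borel_measurable (borel :: (real \<times> real) measure)"
    "snd \<in> borel_measurable (borel :: (real \<times> real) measure)"
    by (simp_all add: borel_prod[symmetric])
  have F[measurable]: "F i \<in> borel_measurable borel" for i
    unfolding F_def by measurable
  have [simp]: "integrable M (\<lambda>\<omega>. F i (increment \<delta> i \<omega>))" for i
    by (rule integrable_const_bound[of _ 1]) (auto simp: F_def norm_mult)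
  have EF: "(\<integral>\<omega>. F i (increment \<delta> i \<omega>) \<partial>M) = (if i < j then cf_nojump \<delta> y else cf_L \<delta> y - cf_nojump \<delta> y)" for i
  proof (cases "i < j")
    case True
    have "(\<integral>\<omega>. F i (increment \<delta> i \<omega>) \<partial>M) = (\<integral>\<omega>. F i (N \<delta> \<omega>, L \<delta> \<omega>) \<partial>M)"
      by (rule integral_increment[OF \<delta> F])
    also have "\<dots> = cf_nojump \<delta> y"
      using True expectation_cf_nojump[of \<delta> y] \<delta> by (simp add: F_def)
    finally show ?thesis using True by simp
  next
    case False
    have "(\<integral>\<omega>. F i (increment \<delta> i \<omega>) \<partial>M) = (\<integral>\<omega>. F i (N \<delta> \<omega>, L \<delta> \<omega>) \<partial>M)"
      by (rule integral_increment[OF \<delta> F])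
    also have "\<dots> = (\<integral>\<omega>. iexp (y * L \<delta> \<omega>) - iexp (y * L \<delta> \<omega>) * of_bool (N \<delta> \<omega> = 0) \<partial>M)"
      by (rule Bochner_Integration.integral_cong) (use False in \<open>auto simp: F_def\<close>)
    also have "\<dots> = cf_L \<delta> y - cf_nojump \<delta> y"
      using expectation_cf_nojump[of \<delta> y] expectation_cf_L[of \<delta> y] \<delta>
      by (subst Bochner_Integration.integral_diff)
         (auto intro!: integrable_const_bound[of _ 1] simp: norm_mult simp del: of_real_mult)
    finally show ?thesis using False by simp
  qed
  have "(CLINT \<omega>|M. iexp (y * L (real (Suc j) * \<delta>) \<omega>) * of_bool (first_hit \<delta> j \<omega>))
    = (\<integral>\<omega>. (\<Prod>i<Suc j. F i (increment \<delta> i \<omega>)) \<partial>M)"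
  proof (rule integral_cong_AE)
    have [measurable]: "L (real (Suc j) * \<delta>) \<in> borel_measurable M"
      using \<delta> by (intro L_measurable) simp
    show "(\<lambda>\<omega>. iexp (y * L (real (Suc j) * \<delta>) \<omega>) * of_bool (first_hit \<delta> j \<omega>)) \<in> borel_measurable M"
      using first_hit_measurable[OF \<delta>, of j] by measurable
    show "AE \<omega> in M. iexp (y * L (real (Suc j) * \<delta>) \<omega>) * of_bool (first_hit \<delta> j \<omega>)
      = (\<Prod>i<Suc j. F i (increment \<delta> i \<omega>))"
      using AE_start
    proof eventually_elim
      case (elim \<omega>)
      then have start: "N 0 \<omega> = 0" "L 0 \<omega> = 0" by auto
      have "L (real (Suc j) * \<delta>) \<omega> = (\<Sum>i<Suc j. snd (increment \<delta> i \<omega>))"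
        using arg_cong[OF sum_increments[OF start, of "Suc j" \<delta>], of snd] by (simp only: snd_sum snd_conv)
      then have "iexp (y * L (real (Suc j) * \<delta>) \<omega>) = (\<Prod>i<Suc j. iexp (y * snd (increment \<delta> i \<omega>)))"
        by (simp only: exp_sum[OF finite_lessThan, symmetric] of_real_sum sum_distrib_left)
      moreover have "of_bool (first_hit \<delta> j \<omega>)
        = (\<Prod>i<Suc j. of_bool (if i < j then fst (increment \<delta> i \<omega>) = 0 else fst (increment \<delta> i \<omega>) \<noteq> 0) :: complex)"
        unfolding first_hit_iff_increments[OF start]
        by (auto simp: prod_zero_iff)
      ultimately show ?case unfolding F_def prod.distrib by simp
    qed
  qed (use \<delta> in measurable)
  also have "\<dots> = (\<Prod>i<Suc j. \<integral>\<omega>. F i (increment \<delta> i \<omega>) \<partial>M)"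
    by (rule indep_vars_lebesgue_integral)
       (auto intro: indep_vars_compose2[OF indep_increments[OF \<delta>]])
  also have "\<dots> = cf_nojump \<delta> y ^ j * (cf_L \<delta> y - cf_nojump \<delta> y)"
    unfolding EF by simp
  finally show ?thesis .
qed

text \<open>Since \<open>Re (iexp y) \<le> 1\<close>, the exponent has real part at most
  \<open>- \<delta> (u + w)\<close>.\<close>

lemma norm_cf_nojump_less_1:
  assumes "\<delta> > 0" shows "norm (cf_nojump \<delta> y) < 1"
proof -
  have "Re (iexp y) \<le> 1" by (simp add: Re_exp)
  then have "v * (Re (iexp y) - 1) - u - w < 0"
    using rates mult_nonneg_nonpos[of v "Re (iexp y) - 1"] by auto
  then show ?thesis using assms by (simp add: cf_nojump_def mult_pos_neg)
qed

text \<open>The events \<open>first_hit \<delta> j\<close> are disjoint, so the partial sums are the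
  stopped exponential cut off after \<open>n\<close> grid steps, bounded by 1; termwise integration
  gives a geometric series. The indicator is kept because existence of a hit is not yet
  known.\<close>

lemma expectation_stopped:
  assumes \<delta>: "\<delta> > 0"
  shows "(CLINT \<omega>|M. iexp (y * L (grid_hit_time (\<lambda>t. N t \<omega>) \<delta>) \<omega>) * of_bool (\<exists>j. first_hit \<delta> j \<omega>))
    = (cf_L \<delta> y - cf_nojump \<delta> y) / (1 - cf_nojump \<delta> y)"
proof -
  note [measurable] = first_hit_measurable[OF \<delta>]
  have [measurable]: "L (real (Suc j) * \<delta>) \<in> borel_measurable M" for j
    using \<delta> by (intro L_measurable) simp
  define f where "f j \<omega> = iexp (y * L (real (Suc j) * \<delta>) \<omega>) * of_bool (first_hit \<delta> j \<omega>)" for j \<omega>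
  define g where "g \<omega> = iexp (y * L (grid_hit_time (\<lambda>t. N t \<omega>) \<delta>) \<omega>) * of_bool (\<exists>j. first_hit \<delta> j \<omega>)" for \<omega>
  have [measurable]: "f j \<in> borel_measurable M" for j unfolding f_def by measurable
  have partial: "(\<Sum>j<n. f j \<omega>) = (if \<exists>j<n. first_hit \<delta> j \<omega> then g \<omega> else 0)" for n \<omega>
  proof (cases "\<exists>j<n. first_hit \<delta> j \<omega>")
    case True
    then obtain j where j: "j < n" "first_hit \<delta> j \<omega>" by auto
    have "(\<Sum>j<n. f j \<omega>) = (\<Sum>i\<in>{j}. f i \<omega>)"
    proof (rule sum.mono_neutral_right)
      show "\<forall>i\<in>{..<n} - {j}. f i \<omega> = 0"
        using first_hit_unique[OF j(2)] by (auto simp: f_def)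
    qed (use j in auto)
    also have "\<dots> = g \<omega>"
      using j(2) by (auto simp: f_def g_def grid_hit_time_def first_hit_grid_hit)
    finally show ?thesis using True by simp
  qed (auto simp: f_def)
  have lim: "(\<lambda>n. \<Sum>j<n. f j \<omega>) \<longlonglongrightarrow> g \<omega>" for \<omega>
  proof (cases "\<exists>j. first_hit \<delta> j \<omega>")
    case True
    then obtain j where j: "first_hit \<delta> j \<omega>" by auto
    have "eventually (\<lambda>n. (\<Sum>j<n. f j \<omega>) = g \<omega>) sequentially"
      using eventually_gt_at_top[of j] by eventually_elim (use j in \<open>auto simp: partial\<close>)
    then show ?thesis by (rule tendsto_eventually)
  qed (simp add: partial g_def)
  have [measurable]: "g \<in> borel_measurable M"
    by (rule borel_measurable_LIMSEQ_metric[OF _ lim]) measurable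
  have "(\<lambda>n. \<integral>\<omega>. (\<Sum>j<n. f j \<omega>) \<partial>M) \<longlonglongrightarrow> (\<integral>\<omega>. g \<omega> \<partial>M)"
  proof (rule integral_dominated_convergence[where w="\<lambda>_. 1"])
    show "AE \<omega> in M. norm (\<Sum>j<n. f j \<omega>) \<le> 1" for n
      unfolding partial by (auto simp: g_def norm_mult)
  qed (auto simp: lim)
  moreover have "(\<integral>\<omega>. (\<Sum>j<n. f j \<omega>) \<partial>M) = (\<Sum>j<n. cf_nojump \<delta> y ^ j * (cf_L \<delta> y - cf_nojump \<delta> y))" for n
  proof -
    have "integrable M (f j)" for j
      by (rule integrable_const_bound[of _ 1]) (auto simp: f_def norm_mult)
    then show ?thesis
      unfolding expectation_first_hit[OF \<delta>, symmetric] f_def[symmetric]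
      by (rule Bochner_Integration.integral_sum)
  qed
  moreover have "(\<lambda>n. \<Sum>j<n. cf_nojump \<delta> y ^ j * (cf_L \<delta> y - cf_nojump \<delta> y))
    \<longlonglongrightarrow> 1 / (1 - cf_nojump \<delta> y) * (cf_L \<delta> y - cf_nojump \<delta> y)"
    using sums_mult2[OF geometric_sums[OF norm_cf_nojump_less_1[OF \<delta>]]] unfolding sums_def .
  ultimately show ?thesis unfolding g_def[symmetric] by (simp add: LIMSEQ_unique)
qed

text \<open>The choice \<open>y = 0\<close> in the previous formula turns the left side into the
  probability of a hit and, as \<open>cf_L \<delta> 0 = 1\<close>, the right side into 1.\<close>

lemma AE_first_hit:
  assumes \<delta>: "\<delta> > 0" shows "AE \<omega> in M. \<exists>j. first_hit \<delta> j \<omega>"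
proof -
  note [measurable] = first_hit_measurable[OF \<delta>]
  have "norm (cf_nojump \<delta> 0) < 1" by (rule norm_cf_nojump_less_1[OF \<delta>])
  then have ne: "1 - cf_nojump \<delta> 0 \<noteq> 0" by auto
  have "(\<integral>\<omega>. complex_of_real (of_bool (\<exists>j. first_hit \<delta> j \<omega>)) \<partial>M) = (\<integral>\<omega>. of_bool (\<exists>j. first_hit \<delta> j \<omega>) \<partial>M)"
    by (rule Bochner_Integration.integral_cong) auto
  also have "\<dots> = 1"
    using expectation_stopped[OF \<delta>, of 0] ne by (simp add: cf_L_def)
  finally have "(\<integral>\<omega>. complex_of_real (of_bool (\<exists>j. first_hit \<delta> j \<omega>)) \<partial>M) = 1" .
  then have "(\<integral>\<omega>. of_bool (\<exists>j. first_hit \<delta> j \<omega>) \<partial>M) = (1::real)"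
    unfolding integral_complex_of_real of_real_eq_1_iff .
  also have "(\<lambda>\<omega>. of_bool (\<exists>j. first_hit \<delta> j \<omega>) :: real) = indicator {\<omega>. \<exists>j. first_hit \<delta> j \<omega>}"
    by (auto simp: indicator_def)
  finally have "prob ({\<omega>. \<exists>j. first_hit \<delta> j \<omega>} \<inter> space M) = 1" by simp
  moreover have "{\<omega>. \<exists>j. first_hit \<delta> j \<omega>} \<inter> space M = {\<omega> \<in> space M. \<exists>j. first_hit \<delta> j \<omega>}" by auto
  ultimately show ?thesis by (simp add: prob_Collect_eq_1)
qed

end

section \<open>Letting the mesh tend to 0\<close>

lemma tendsto_exp_difference_quotient:
  fixes a c :: complex
  assumes c: "c \<noteq> 0"
  shows "(\<lambda>n. (exp (of_real (1 / real (Suc n)) * a) - exp (of_real (1 / real (Suc n)) * c))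
      / (1 - exp (of_real (1 / real (Suc n)) * c))) \<longlonglongrightarrow> (a - c) / (- c)"
proof -
  define \<delta> where "\<delta> n = complex_of_real (1 / real (Suc n))" for n
  have \<delta>: "\<delta> n \<noteq> 0" for n unfolding \<delta>_def of_real_eq_0_iff by simp
  have "\<delta> \<longlonglongrightarrow> of_real 0"
    unfolding \<delta>_def using LIMSEQ_inverse_real_of_nat
    by (intro tendsto_of_real) (simp add: inverse_eq_divide)
  then have lim: "filterlim \<delta> (at 0) sequentially"
    using \<delta> by (auto simp: filterlim_at)
  have q: "(\<lambda>n. (exp (\<delta> n * z) - 1) / \<delta> n) \<longlonglongrightarrow> z" for z
  proof -
    have "((\<lambda>h. exp (h * z)) has_field_derivative z) (at 0)"
      by (auto intro!: derivative_eq_intros)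
    then have "((\<lambda>h. (exp ((0 + h) * z) - exp (0 * z)) / h) \<longlongrightarrow> z) (at 0)"
      unfolding DERIV_def .
    from filterlim_compose[OF this lim] show ?thesis by simp
  qed
  \<comment> \<open>Numerator and denominator are divided by \<open>\<delta> n\<close>; each
    difference quotient tends to the derivative of \<open>exp (h * z)\<close> at
    \<open>h = 0\<close>.\<close>
  have "(\<lambda>n. ((exp (\<delta> n * a) - 1) / \<delta> n - (exp (\<delta> n * c) - 1) / \<delta> n) / (- ((exp (\<delta> n * c) - 1) / \<delta> n)))
    \<longlonglongrightarrow> (a - c) / (- c)"
    by (intro tendsto_divide tendsto_diff tendsto_minus q) (use c in simp)
  also have "(\<lambda>n. ((exp (\<delta> n * a) - 1) / \<delta> n - (exp (\<delta> n * c) - 1) / \<delta> n) / (- ((exp (\<delta> n * c) - 1) / \<delta> n)))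
    = (\<lambda>n. (exp (\<delta> n * a) - exp (\<delta> n * c)) / (1 - exp (\<delta> n * c)))"
  proof
    fix n
    have "((exp (\<delta> n * a) - 1) / \<delta> n - (exp (\<delta> n * c) - 1) / \<delta> n) / (- ((exp (\<delta> n * c) - 1) / \<delta> n))
      = ((exp (\<delta> n * a) - exp (\<delta> n * c)) / \<delta> n) / ((1 - exp (\<delta> n * c)) / \<delta> n)"
      by (simp add: diff_divide_distrib)
    then show "((exp (\<delta> n * a) - 1) / \<delta> n - (exp (\<delta> n * c) - 1) / \<delta> n) / (- ((exp (\<delta> n * c) - 1) / \<delta> n))
      = (exp (\<delta> n * a) - exp (\<delta> n * c)) / (1 - exp (\<delta> n * c))"
      using \<delta>[of n] by simp
  qed
  finally show ?thesis unfolding \<delta>_def .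
qed

context marked_poisson begin

lemma stopped_measurable [measurable]:
  assumes \<delta>: "\<delta> > 0"
  shows "(\<lambda>\<omega>. L (grid_hit_time (\<lambda>t. N t \<omega>) \<delta>) \<omega>) \<in> borel_measurable M"
proof -
  have [measurable]: "L (real (Suc j) * \<delta>) \<in> borel_measurable M" "N (real (Suc j) * \<delta>) \<in> borel_measurable M" for j
    using \<delta> by (auto intro!: L_measurable N_measurable)
  show ?thesis
    unfolding grid_hit_time_def grid_hit_def
    by (rule measurable_compose_countable[where f="\<lambda>j. L (real (Suc j) * \<delta>)"]) measurable
qed

text \<open>\<open>Y\<close> is a limit of grid values, hence measurable for \<open>M\<close>, and
  agrees almost surely with \<open>L\<close> at the first jump time: the grid times approach that
  time from the right, where right continuity of \<open>L\<close> applies.\<close>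

lemma rho_eq_limit:
  obtains Y where "Y \<in> borel_measurable M" "rho M N L = distr M borel Y"
    "AE \<omega> in M. (\<lambda>n. L (grid_hit_time (\<lambda>t. N t \<omega>) (1 / real (Suc n))) \<omega>) \<longlonglongrightarrow> Y \<omega>"
proof -
  define Z where "Z n \<omega> = L (grid_hit_time (\<lambda>t. N t \<omega>) (1 / real (Suc n))) \<omega>" for n \<omega>
  define Y where "Y \<omega> = lim (\<lambda>n. Z n \<omega>)" for \<omega>
  have [measurable]: "Z n \<in> borel_measurable M" for n
    unfolding Z_def[abs_def] by (rule stopped_measurable) simp
  have Y[measurable]: "Y \<in> borel_measurable M"
    unfolding Y_def[abs_def] by (rule borel_measurable_lim_metric) simp
  have "AE \<omega> in M. \<forall>i n. N (real i / real (Suc n)) \<omega> \<in> \<int>"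
    unfolding AE_all_countable by (intro allI AE_N_int) simp
  moreover have "AE \<omega> in M. \<forall>n. \<exists>j. first_hit (1 / real (Suc n)) j \<omega>"
    unfolding AE_all_countable by (intro allI AE_first_hit) simp
  ultimately have *: "AE \<omega> in M. (\<lambda>n. Z n \<omega>) \<longlonglongrightarrow> L (real_of_ereal (first_jump_time (\<lambda>t. N t \<omega>))) \<omega>"
    using AE_right_continuous AE_start
  proof eventually_elim
    case (elim \<omega>)
    have "\<exists>j. N (real (Suc j) * (1 / real (Suc n))) \<omega> \<noteq> 0" for n
      using elim(2) unfolding first_hit_def by blast
    then obtain \<tau> where \<tau>: "first_jump_time (\<lambda>t. N t \<omega>) = ereal \<tau>" "\<tau> > 0"
      "\<And>n. grid_hit_time (\<lambda>t. N t \<omega>) (1 / real (Suc n)) \<ge> \<tau>"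
      "(\<lambda>n. grid_hit_time (\<lambda>t. N t \<omega>) (1 / real (Suc n))) \<longlonglongrightarrow> \<tau>"
      using grid_hit_time_tendsto_first_jump_time[of "\<lambda>t. N t \<omega>"] elim by blast
    have "((\<lambda>s. L s \<omega>) \<longlongrightarrow> L \<tau> \<omega>) (at_right \<tau>)" using elim(3) \<tau>(2) by auto
    from right_continuous_sequentially[OF this \<tau>(3,4)] show ?case
      unfolding Z_def \<tau>(1) by simp
  qed
  then have eq: "AE \<omega> in M. L (real_of_ereal (first_jump_time (\<lambda>t. N t \<omega>))) \<omega> = Y \<omega>"
    by eventually_elim (simp add: Y_def limI)
  show thesis
  proof (rule that[OF Y])
    show "rho M N L = distr M borel Y"
      unfolding rho_def by (rule distr_completion_AE_eq[OF Y eq])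
    show "AE \<omega> in M. (\<lambda>n. L (grid_hit_time (\<lambda>t. N t \<omega>) (1 / real (Suc n))) \<omega>) \<longlonglongrightarrow> Y \<omega>"
      using * eq by eventually_elim (simp add: Z_def)
  qed
qed

theorem rho_characteristic_function:
  shows "real_distribution (rho M N L)"
    and "char (rho M N L) y = (u + w * iexp (y * b)) / (u + v + w - v * iexp y)"
proof -
  obtain Y where [measurable]: "Y \<in> borel_measurable M" and rho: "rho M N L = distr M borel Y"
    and lim: "AE \<omega> in M. (\<lambda>n. L (grid_hit_time (\<lambda>t. N t \<omega>) (1 / real (Suc n))) \<omega>) \<longlonglongrightarrow> Y \<omega>"
    by (rule rho_eq_limit)
  show "real_distribution (rho M N L)" unfolding rho by (rule real_distribution_distr) simp
  \<comment> \<open>Exponential rates of \<open>cf_L\<close> and \<open>cf_nojump\<close>: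
    \<open>a - c\<close> is the numerator and \<open>- c\<close> the denominator of the
    claim.\<close>
  define a where "a = v * (iexp y - 1) + w * (iexp (y * b) - 1)"
  define c where "c = v * (iexp y - 1) - u - w"
  have "Re (iexp y) \<le> 1" by (simp add: Re_exp)
  then have "v * (Re (iexp y) - 1) - u - w < 0"
    using rates mult_nonneg_nonpos[of v "Re (iexp y) - 1"] by auto
  then have "Re c < 0" by (simp add: c_def)
  then have c: "c \<noteq> 0" by auto
  define Z where "Z n \<omega> = L (grid_hit_time (\<lambda>t. N t \<omega>) (1 / real (Suc n))) \<omega>" for n \<omega>
  have [measurable]: "Z n \<in> borel_measurable M" for n
    unfolding Z_def[abs_def] by (rule stopped_measurable) simp
  have "(CLINT \<omega>|M. iexp (y * Z n \<omega>)) = (CLINT \<omega>|M. iexp (y * Z n \<omega>) * of_bool (\<exists>j. first_hit (1 / real (Suc n)) j \<omega>))" for n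
  proof (rule integral_cong_AE)
    show "AE \<omega> in M. iexp (y * Z n \<omega>) = iexp (y * Z n \<omega>) * of_bool (\<exists>j. first_hit (1 / real (Suc n)) j \<omega>)"
      using AE_first_hit[of "1 / real (Suc n)"] by (auto elim!: eventually_mono)
    have [measurable]: "Measurable.pred M (first_hit (1 / real (Suc n)) j)" for j
      by (rule first_hit_measurable) simp
    show "(\<lambda>\<omega>. iexp (y * Z n \<omega>) * of_bool (\<exists>j. first_hit (1 / real (Suc n)) j \<omega>)) \<in> borel_measurable M"
      by measurable
  qed simp
  also have "\<dots> n = (exp (of_real (1 / real (Suc n)) * a) - exp (of_real (1 / real (Suc n)) * c))
      / (1 - exp (of_real (1 / real (Suc n)) * c))" for n
    unfolding Z_def by (subst expectation_stopped) (simp_all add: cf_L_def cf_nojump_def a_def c_def)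
  finally have eq: "(CLINT \<omega>|M. iexp (y * Z n \<omega>)) = (exp (of_real (1 / real (Suc n)) * a) - exp (of_real (1 / real (Suc n)) * c))
      / (1 - exp (of_real (1 / real (Suc n)) * c))" for n .
  have "(\<lambda>n. CLINT \<omega>|M. iexp (y * Z n \<omega>)) \<longlonglongrightarrow> (CLINT \<omega>|M. iexp (y * Y \<omega>))"
  proof (rule integral_dominated_convergence[where w="\<lambda>_. 1"])
    show "AE \<omega> in M. (\<lambda>n. iexp (y * Z n \<omega>)) \<longlonglongrightarrow> iexp (y * Y \<omega>)"
      using lim by eventually_elim (auto simp: Z_def intro!: tendsto_intros)
  qed auto
  then have "(\<lambda>n. (exp (of_real (1 / real (Suc n)) * a) - exp (of_real (1 / real (Suc n)) * c))
      / (1 - exp (of_real (1 / real (Suc n)) * c))) \<longlonglongrightarrow> (CLINT \<omega>|M. iexp (y * Y \<omega>))"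
    unfolding eq .
  then have "(CLINT \<omega>|M. iexp (y * Y \<omega>)) = (a - c) / (- c)"
    by (rule LIMSEQ_unique[OF _ tendsto_exp_difference_quotient[OF c]])
  also have "\<dots> = (u + w * iexp (y * b)) / (u + v + w - v * iexp y)"
    by (rule arg_cong2[of _ _ _ _ "(/)"]) (simp_all add: a_def c_def algebra_simps)
  finally show "char (rho M N L) y = (u + w * iexp (y * b)) / (u + v + w - v * iexp y)"
    unfolding rho char_def by (subst integral_distr) auto
qed

end

section \<open>Characteristic functions and infinite divisibility\<close>

lemma real_distribution_convolution:
  assumes "real_distribution A" "real_distribution B" shows "real_distribution (convolution A B)"
proof -
  interpret A: real_distribution A by fact
  interpret B: real_distribution B by fact
  interpret AB: pair_prob_space A B ..
  show ?thesis unfolding convolution_def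
    by (rule AB.real_distribution_distr) measurable
qed

lemma char_convolution:
  assumes "real_distribution A" "real_distribution B"
  shows "char (convolution A B) t = char A t * char B t"
proof -
  interpret A: real_distribution A by fact
  interpret B: real_distribution B by fact
  interpret AB: pair_prob_space A B ..
  have "char (convolution A B) t = (\<integral>z. iexp (t * (fst z + snd z)) \<partial>(A \<Otimes>\<^sub>M B))"
    unfolding char_def convolution_def by (subst integral_distr) (auto simp: case_prod_beta)
  also have "\<dots> = (\<integral>x. \<integral>y. iexp (t * (x + y)) \<partial>B \<partial>A)"
    by (subst AB.integral_fst'[symmetric]) (auto intro!: AB.integrable_const_bound[of _ 1])
  also have "\<dots> = (\<integral>x. iexp (t * x) * char B t \<partial>A)"
    unfolding distrib_left iexp_add char_def by simp
  also have "\<dots> = char A t * char B t"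
    unfolding char_def by simp
  finally show ?thesis .
qed

lemma real_distribution_return: "real_distribution (return borel (x::real))"
  by (simp add: real_distribution_def real_distribution_axioms_def prob_space_return)

lemma char_return: "char (return borel x) t = iexp (t * x)"
  unfolding char_def by (subst integral_return) auto

lemma convolution_funpow:
  assumes "real_distribution \<nu>"
  shows "real_distribution ((convolution \<nu> ^^ n) (return borel 0))"
    and "char ((convolution \<nu> ^^ n) (return borel 0)) t = char \<nu> t ^ n"
proof -
  have "real_distribution ((convolution \<nu> ^^ n) (return borel 0)) \<and>
    char ((convolution \<nu> ^^ n) (return borel 0)) t = char \<nu> t ^ n"
    by (induction n)
       (auto simp: real_distribution_return char_return char_convolution assms intro: real_distribution_convolution assms)
  then show "real_distribution ((convolution \<nu> ^^ n) (return borel 0))"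
    and "char ((convolution \<nu> ^^ n) (return borel 0)) t = char \<nu> t ^ n" by auto
qed

lemma infinitely_divisible_iff_char:
  assumes \<mu>: "real_distribution \<mu>"
  shows "infinitely_divisible \<mu> \<longleftrightarrow>
    (\<forall>n\<ge>1. \<exists>\<nu>. real_distribution \<nu> \<and> (\<forall>t. char \<mu> t = char \<nu> t ^ n))"
proof -
  have "\<mu> = (convolution \<nu> ^^ n) (return borel 0) \<longleftrightarrow> (\<forall>t. char \<mu> t = char \<nu> t ^ n)"
    if "real_distribution \<nu>" for \<nu> n
    using Levy_uniqueness[OF \<mu> convolution_funpow(1)[OF that, of n]] convolution_funpow(2)[OF that, of n]
    by (auto simp: fun_eq_iff)
  then show ?thesis unfolding infinitely_divisible_def using \<mu> by metis
qed

section \<open>Compound Poisson laws with countably many atoms\<close>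

lemma norm_integral_pmf_le_1:
  fixes f :: "'b \<Rightarrow> complex"
  assumes f: "\<And>x. norm (f x) \<le> 1"
  shows "norm (\<integral>x. f x \<partial>measure_pmf p) \<le> 1"
proof -
  have "norm (\<integral>x. f x \<partial>measure_pmf p) \<le> (\<integral>x. norm (f x) \<partial>measure_pmf p)"
    by (rule integral_norm_bound)
  also have "\<dots> \<le> 1"
    by (rule measure_pmf.integral_le_const) (auto intro!: measure_pmf.integrable_const_bound[of _ 1] simp: f)
  finally show ?thesis .
qed

lemma integral_bind_pmf_complex:
  fixes f :: "'b \<Rightarrow> complex"
  assumes f: "\<And>x. norm (f x) \<le> 1"
  shows "(\<integral>x. f x \<partial>bind_pmf p q) = (\<integral>x. \<integral>y. f y \<partial>q x \<partial>p)"
proof -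
  have bind: "(\<integral>x. g x \<partial>bind_pmf p q) = (\<integral>x. \<integral>y. g y \<partial>q x \<partial>p)" if "\<And>x. \<bar>g x\<bar> \<le> 1" for g :: "'b \<Rightarrow> real"
    unfolding measure_pmf_bind
    by (rule integral_bind[where K="count_space UNIV" and B=1 and B'=1])
       (auto simp: that measure_pmf.finite_measure_axioms space_subprob_algebra measure_pmf.subprob_space_axioms)
  have int: "integrable (measure_pmf m) f" for m
    by (rule measure_pmf.integrable_const_bound[of _ 1]) (auto simp: f)
  have int2: "integrable (measure_pmf p) (\<lambda>x. \<integral>y. f y \<partial>q x)"
  proof (rule measure_pmf.integrable_const_bound[of _ 1])
    show "AE x in p. norm (\<integral>y. f y \<partial>q x) \<le> 1"
      by (intro AE_I2 norm_integral_pmf_le_1 f)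
  qed simp
  show ?thesis
  proof (rule complex_eqI)
    show "Re (\<integral>x. f x \<partial>bind_pmf p q) = Re (\<integral>x. \<integral>y. f y \<partial>q x \<partial>p)"
      unfolding integral_Re[OF int, symmetric] integral_Re[OF int2, symmetric]
      by (rule bind) (use f abs_Re_le_cmod order_trans in blast)
    show "Im (\<integral>x. f x \<partial>bind_pmf p q) = Im (\<integral>x. \<integral>y. f y \<partial>q x \<partial>p)"
      unfolding integral_Im[OF int, symmetric] integral_Im[OF int2, symmetric]
      by (rule bind) (use f abs_Im_le_cmod order_trans in blast)
  qed
qed

lemma sums_integral_nat_pmf:
  fixes f :: "nat \<Rightarrow> complex"
  assumes f: "\<And>x. norm (f x) \<le> 1"
  shows "(\<lambda>j. of_real (pmf p j) * f j) sums (\<integral>x. f x \<partial>measure_pmf p)"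
proof -
  have "integrable (measure_pmf p) f"
    by (rule measure_pmf.integrable_const_bound[of _ 1]) (auto simp: f)
  then have "integrable (count_space UNIV) (\<lambda>j. pmf p j *\<^sub>R f j)"
    unfolding measure_pmf_eq_density by (subst (asm) integrable_density) (auto simp: comp_def)
  from sums_integral_count_space_nat[OF this]
  have "(\<lambda>j. pmf p j *\<^sub>R f j) sums (\<integral>x. f x \<partial>measure_pmf p)"
    unfolding measure_pmf_eq_density by (subst integral_density) (auto simp: comp_def)
  then show ?thesis by (simp add: scaleR_conv_of_real)
qed

text \<open>Staying within \<open>pmf\<close> lets the number of independent summands be randomised
  by \<open>bind_pmf\<close>.\<close>

primrec sum_pmf :: "real pmf \<Rightarrow> nat \<Rightarrow> real pmf" where
  "sum_pmf J 0 = return_pmf 0"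
| "sum_pmf J (Suc n) = bind_pmf J (\<lambda>x. map_pmf ((+) x) (sum_pmf J n))"

lemma integral_iexp_sum_pmf:
  "(\<integral>x. iexp (t * x) \<partial>sum_pmf J n) = (\<integral>x. iexp (t * x) \<partial>measure_pmf J) ^ n"
proof (induction n)
  case (Suc n)
  have "(\<integral>x. iexp (t * x) \<partial>sum_pmf J (Suc n)) = (\<integral>x. \<integral>y. iexp (t * (x + y)) \<partial>sum_pmf J n \<partial>J)"
    by (simp add: integral_bind_pmf_complex)
  also have "\<dots> = (\<integral>x. iexp (t * x) * (\<integral>y. iexp (t * y) \<partial>sum_pmf J n) \<partial>J)"
    unfolding distrib_left iexp_add by simp
  finally show ?case unfolding Suc.IH by simp
qed simp

text \<open>The law is that of a Poisson number, of mean \<open>suminf a\<close>, of independent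
  steps equal to \<open>x j\<close> with probability \<open>a j / suminf a\<close>. The points
  \<open>x j\<close> may repeat, since the step law is the image of a law on indices.\<close>

lemma compound_poisson_exists:
  fixes a x :: "nat \<Rightarrow> real"
  assumes a: "\<And>j. a j \<ge> 0" "summable a"
  shows "\<exists>\<nu>. real_distribution \<nu> \<and> (\<forall>t. char \<nu> t = exp (\<Sum>j. of_real (a j) * (iexp (t * x j) - 1)))"
proof (cases "suminf a = 0")
  case True
  \<comment> \<open>With zero total mass there is nothing to normalise, and the Dirac measure at 0
    serves.\<close>
  then have "a j = 0" for j using suminf_eq_zero_iff[OF a(2,1)] by simp
  then show ?thesis
    by (intro exI[of _ "return borel 0"]) (simp add: real_distribution_return char_return)
next
  case False
  define \<kappa> where "\<kappa> = suminf a"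
  have \<kappa>: "\<kappa> > 0" using False suminf_nonneg[OF a(2,1)] by (simp add: \<kappa>_def)
  define J0 where "J0 = embed_pmf (\<lambda>j. a j / \<kappa>)"
  have "(\<integral>\<^sup>+j. ennreal (a j / \<kappa>) \<partial>count_space UNIV) = ennreal (\<Sum>j. a j / \<kappa>)"
    unfolding nn_integral_count_space_nat
    by (rule suminf_ennreal2) (use a \<kappa> in \<open>auto intro: summable_divide\<close>)
  also have "(\<Sum>j. a j / \<kappa>) = 1"
    using suminf_divide[OF a(2), of \<kappa>] \<kappa> by (simp add: \<kappa>_def)
  finally have J0: "pmf J0 j = a j / \<kappa>" for j
    unfolding J0_def by (intro pmf_embed_pmf) (use a \<kappa> in auto)
  define J where "J = map_pmf x J0"
  define P where "P = bind_pmf (poisson_pmf \<kappa>) (sum_pmf J)"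
  define \<nu> where "\<nu> = distr (measure_pmf P) borel (\<lambda>x. x)"
  have "real_distribution \<nu>"
    unfolding \<nu>_def by (rule prob_space.real_distribution_distr[OF measure_pmf.prob_space_axioms]) simp
  moreover have "char \<nu> t = exp (\<Sum>j. of_real (a j) * (iexp (t * x j) - 1))" for t
  proof -
    define \<phi> where "\<phi> = (\<integral>y. iexp (t * y) \<partial>measure_pmf J)"
    have \<phi>1: "norm \<phi> \<le> 1"
      unfolding \<phi>_def by (rule norm_integral_pmf_le_1) simp
    have "char \<nu> t = (\<integral>n. \<integral>y. iexp (t * y) \<partial>sum_pmf J n \<partial>poisson_pmf \<kappa>)"
      unfolding char_def \<nu>_def P_def by (subst integral_distr) (auto simp: integral_bind_pmf_complex)
    also have "\<dots> = (\<integral>n. \<phi> ^ n \<partial>poisson_pmf \<kappa>)"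
      unfolding integral_iexp_sum_pmf \<phi>_def ..
    also have "\<dots> = exp (of_real \<kappa> * (\<phi> - 1))"
    proof (rule sums_unique2)
      show "(\<lambda>n. of_real (pmf (poisson_pmf \<kappa>) n) * \<phi> ^ n) sums (\<integral>n. \<phi> ^ n \<partial>poisson_pmf \<kappa>)"
        by (rule sums_integral_nat_pmf) (simp add: norm_power power_le_one \<phi>1)
      have "(\<lambda>n. exp (- of_real \<kappa>) * ((of_real \<kappa> * \<phi>) ^ n /\<^sub>R fact n)) sums (exp (- of_real \<kappa>) * exp (of_real \<kappa> * \<phi>))"
        by (intro sums_mult exp_converges)
      also have "exp (- of_real \<kappa>) * exp (of_real \<kappa> * \<phi>) = exp (of_real \<kappa> * (\<phi> - 1))"
        unfolding exp_add[symmetric] by (simp add: algebra_simps)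
      also have "(\<lambda>n. exp (- of_real \<kappa>) * ((of_real \<kappa> * \<phi>) ^ n /\<^sub>R fact n)) = (\<lambda>n. of_real (pmf (poisson_pmf \<kappa>) n) * \<phi> ^ n)"
        using \<kappa> by (auto simp: power_mult_distrib exp_of_real scaleR_conv_of_real field_simps exp_minus)
      finally show "(\<lambda>n. of_real (pmf (poisson_pmf \<kappa>) n) * \<phi> ^ n) sums exp (of_real \<kappa> * (\<phi> - 1))" .
    qed
    also have "of_real \<kappa> * (\<phi> - 1) = (\<Sum>j. of_real (a j) * (iexp (t * x j) - 1))"
    proof (rule sums_unique)
      have "\<phi> = (\<integral>j. iexp (t * x j) \<partial>measure_pmf J0)" by (simp add: \<phi>_def J_def)
      then have "(\<lambda>j. of_real (pmf J0 j) * iexp (t * x j)) sums \<phi>"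
        using sums_integral_nat_pmf[of "\<lambda>j. iexp (t * x j)" J0] by simp
      then have "(\<lambda>j. of_real \<kappa> * (of_real (pmf J0 j) * iexp (t * x j))) sums (of_real \<kappa> * \<phi>)"
        by (rule sums_mult)
      then have "(\<lambda>j. of_real (a j) * iexp (t * x j)) sums (of_real \<kappa> * \<phi>)"
        using \<kappa> by (simp add: J0)
      moreover have "(\<lambda>j. complex_of_real (a j)) sums of_real \<kappa>"
        unfolding \<kappa>_def using summable_sums[OF a(2)] by (rule sums_of_real)
      ultimately have "(\<lambda>j. of_real (a j) * iexp (t * x j) - of_real (a j)) sums (of_real \<kappa> * \<phi> - of_real \<kappa>)"
        by (rule sums_diff)
      then show "(\<lambda>j. of_real (a j) * (iexp (t * x j) - 1)) sums (of_real \<kappa> * (\<phi> - 1))"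
        by (simp add: algebra_simps)
    qed
    finally show ?thesis .
  qed
  ultimately show ?thesis by blast
qed

section \<open>Logarithms of convolution roots\<close>

lemma norm_exp_minus_1_minus_le:
  fixes z :: complex
  assumes "norm z \<le> 1" shows "norm (exp z - 1 - z) \<le> (norm z)\<^sup>2"
proof -
  have tail: "(\<lambda>k. w ^ (k + 2) /\<^sub>R fact (k + 2)) sums (exp w - 1 - w)" for w :: "'b::{real_normed_field,banach}"
    using sums_split_initial_segment[OF exp_converges[of w], of 2] by (simp add: numeral_2_eq_2 algebra_simps)
  have "norm (exp z - 1 - z) = norm (\<Sum>k. z ^ (k + 2) /\<^sub>R fact (k + 2))"
    using sums_unique[OF tail[of z]] by simp
  also have "\<dots> \<le> (\<Sum>k. norm z ^ (k + 2) /\<^sub>R fact (k + 2))"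
  proof (rule norm_suminf_le)
    show "norm (z ^ (k + 2) /\<^sub>R fact (k + 2)) \<le> norm z ^ (k + 2) /\<^sub>R fact (k + 2)" for k
      by (simp only: norm_scaleR norm_power) simp
  qed (rule sums_summable[OF tail])
  also have "\<dots> = exp (norm z) - 1 - norm z"
    using sums_unique[OF tail[of "norm z"]] by simp
  also have "\<dots> \<le> (norm z)\<^sup>2" using exp_bound[of "norm z"] assms by simp
  finally show ?thesis .
qed

text \<open>An \<open>n\<close>-th root is fixed only up to a root of unity. The quotient by
  \<open>exp (\<psi> t / n)\<close> is continuous with values in that finite set, hence constant on
  the connected line, and it is 1 at 0.\<close>

lemma char_root_eq_exp:
  assumes \<nu>: "real_distribution \<nu>" and n: "n \<ge> 1"
    and root: "\<And>t. char \<nu> t ^ n = exp (\<psi> t)" and cont: "continuous_on UNIV \<psi>" and "\<psi> 0 = 0"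
  shows "char \<nu> t = exp (\<psi> t / of_nat n)"
proof -
  interpret real_distribution \<nu> by fact
  define g where "g t = char \<nu> t / exp (\<psi> t / of_nat n)" for t
  have "continuous_on UNIV g"
    unfolding g_def using n cont
    by (intro continuous_intros) (auto intro: continuous_at_imp_continuous_on isCont_char)
  moreover have "range g \<subseteq> {z. z ^ n = 1}"
  proof safe
    fix t
    have "exp (\<psi> t / of_nat n) ^ n = exp (\<psi> t)"
      using n by (simp add: exp_of_nat_mult[symmetric])
    then show "g t ^ n = 1" by (simp add: g_def power_divide root)
  qed
  then have "finite (range g)"
    using n by (rule_tac finite_subset) (auto intro: finite_roots_unity)
  ultimately have "g constant_on UNIV" by (intro continuous_finite_range_constant) auto
  then have "g t = g 0" unfolding constant_on_def by auto
  also have "g 0 = 1" using assms char_zero by (simp add: g_def)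
  finally show ?thesis by (simp add: g_def)
qed

text \<open>If \<open>exp \<psi>\<close> has convolution roots \<open>\<nu>\<close> of every order \<open>n\<close>, then \<open>n (char \<nu> - 1)\<close> is
  uniformly within \<open>O(1/n)\<close> of \<open>\<psi>\<close>, and its means at a nonzero frequency converge to
  \<open>n\<close> times a probability. So the means of \<open>\<psi>\<close>, the atoms of a signed Levy measure, are nonnegative.\<close>

lemma infinitely_divisible_mean_nonneg:
  assumes \<mu>: "real_distribution \<mu>" and id: "infinitely_divisible \<mu>"
    and char: "\<And>t. char \<mu> t = exp (\<psi> t)"
    and cont: "continuous_on UNIV \<psi>" and "\<psi> 0 = 0" and bound: "\<And>t. norm (\<psi> t) \<le> K"
    and hx: "iexp (- (h * x)) \<noteq> 1"
    and mean: "(\<lambda>m. (\<Sum>k<m. \<psi> (real k * h) * iexp (real k * - (h * x))) / of_nat m) \<longlonglongrightarrow> l"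
  shows "Re l \<ge> 0"
proof -
  have K: "K \<ge> 0" using bound[of 0] norm_ge_zero order_trans by blast
  \<comment> \<open>\<open>n \<ge> K\<close> puts \<open>\<psi> t / n\<close> in the unit disc,
    where the quadratic remainder estimate holds.\<close>
  have lower: "Re l \<ge> - (K\<^sup>2 / real n)" if n: "n \<ge> 1" "real n \<ge> K" for n
  proof -
    obtain \<nu> where \<nu>: "real_distribution \<nu>" "\<And>t. char \<mu> t = char \<nu> t ^ n"
      using id n unfolding infinitely_divisible_iff_char[OF \<mu>] by blast
    interpret real_distribution \<nu> by fact
    have root: "char \<nu> t = exp (\<psi> t / of_nat n)" for t
      using char_root_eq_exp[OF \<nu>(1) n(1) _ cont] \<nu>(2) char assms(5) by metis
    define P where "P = measure \<nu> {y \<in> space \<nu>. iexp (h * (y - x)) = 1}"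
    have "(\<lambda>m. (\<Sum>k<m. \<integral>y. 1 * iexp (real k * (h * (y - x))) \<partial>\<nu>) / of_nat m)
      \<longlonglongrightarrow> (\<integral>y. 1 * of_bool (iexp (h * (y - x)) = 1) \<partial>\<nu>)"
      by (rule cesaro_mean_integral) auto
    also have "(\<integral>y. 1 * of_bool (iexp (h * (y - x)) = 1) \<partial>\<nu>) = (\<integral>y. complex_of_real (indicator {y \<in> space \<nu>. iexp (h * (y - x)) = 1} y) \<partial>\<nu>)"
      by (rule Bochner_Integration.integral_cong) (auto simp: indicator_def)
    also have "\<dots> = of_real P"
      unfolding integral_complex_of_real P_def by simp
    also have "(\<lambda>k. \<integral>y. 1 * iexp (real k * (h * (y - x))) \<partial>\<nu>) = (\<lambda>k. char \<nu> (real k * h) * iexp (real k * - (h * x)))"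
    proof
      fix k
      have "(\<lambda>y. iexp (real k * (h * (y - x)))) = (\<lambda>y. iexp (real k * h * y) * iexp (real k * - (h * x)))"
        unfolding iexp_add[symmetric] by (simp add: algebra_simps)
      then show "(\<integral>y. 1 * iexp (real k * (h * (y - x))) \<partial>\<nu>) = char \<nu> (real k * h) * iexp (real k * - (h * x))"
        unfolding char_def by simp
    qed
    finally have 1: "(\<lambda>m. (\<Sum>k<m. char \<nu> (real k * h) * iexp (real k * - (h * x))) / of_nat m) \<longlonglongrightarrow> of_real P" .
    \<comment> \<open>The constant 1 in \<open>char \<nu> - 1\<close> sits at the point 0, and
      \<open>hx\<close> keeps it out of the mean.\<close>
    have 2: "(\<lambda>m. (\<Sum>k<m. iexp (real k * - (h * x))) / of_nat m) \<longlonglongrightarrow> 0"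
      using cesaro_mean_iexp[of "- (h * x)"] hx by simp
    \<comment> \<open>Linearisation error: \<open>n\<close> times the quadratic remainder of
      \<open>exp\<close> at \<open>\<psi> t / n\<close>, hence at most \<open>K^2 / n\<close>
      uniformly in \<open>t\<close>.\<close>
    define D where "D t = of_nat n * (char \<nu> t - 1) - \<psi> t" for t
    have "(\<lambda>m. of_nat n * ((\<Sum>k<m. char \<nu> (real k * h) * iexp (real k * - (h * x))) / of_nat m
        - (\<Sum>k<m. iexp (real k * - (h * x))) / of_nat m)
        - (\<Sum>k<m. \<psi> (real k * h) * iexp (real k * - (h * x))) / of_nat m) \<longlonglongrightarrow> of_nat n * (of_real P - 0) - l"
      by (intro tendsto_diff tendsto_mult tendsto_const 1 2 mean)
    also have "(\<lambda>m. of_nat n * ((\<Sum>k<m. char \<nu> (real k * h) * iexp (real k * - (h * x))) / of_nat m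
        - (\<Sum>k<m. iexp (real k * - (h * x))) / of_nat m)
        - (\<Sum>k<m. \<psi> (real k * h) * iexp (real k * - (h * x))) / of_nat m)
      = (\<lambda>m. (\<Sum>k<m. D (real k * h) * iexp (real k * - (h * x))) / of_nat m)"
      unfolding D_def left_diff_distrib sum_subtractf mult.assoc sum_distrib_left[symmetric]
      by (simp only: diff_divide_distrib[symmetric] right_diff_distrib times_divide_eq_right mult_1_left)
    finally have lim: "(\<lambda>m. norm ((\<Sum>k<m. D (real k * h) * iexp (real k * - (h * x))) / of_nat m))
      \<longlonglongrightarrow> norm (of_nat n * (of_real P - 0) - l)"
      by (rule tendsto_norm)
    have D: "norm (D t) \<le> K\<^sup>2 / real n" for t
    proof -
      have le1: "norm (\<psi> t / of_nat n) \<le> 1" using n bound[of t] by (simp add: norm_divide field_simps)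
      have "D t = of_nat n * (exp (\<psi> t / of_nat n) - 1 - \<psi> t / of_nat n)"
        using n by (simp add: D_def root algebra_simps)
      then have "norm (D t) \<le> real n * (norm (\<psi> t / of_nat n))\<^sup>2"
        using norm_exp_minus_1_minus_le[OF le1] by (simp add: norm_mult mult_left_mono)
      also have "\<dots> = (norm (\<psi> t))\<^sup>2 / real n"
        using n by (simp add: norm_divide power_divide power2_eq_square)
      also have "\<dots> \<le> K\<^sup>2 / real n"
        using bound[of t] by (intro divide_right_mono power_mono) auto
      finally show ?thesis .
    qed
    have "norm (of_nat n * (of_real P - 0) - l) \<le> K\<^sup>2 / real n"
      using D by (intro LIMSEQ_le_const2[OF lim] exI[of _ 0] allI impI norm_cesaro_mean_le)
        (auto simp: norm_mult)
    then have "\<bar>Re (of_nat n * (of_real P - 0) - l)\<bar> \<le> K\<^sup>2 / real n"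
      using abs_Re_le_cmod order_trans by blast
    moreover have "real n * P \<ge> 0" by (simp add: P_def)
    ultimately show ?thesis by simp
  qed
  have "(\<lambda>n. - (K\<^sup>2 / real n)) \<longlonglongrightarrow> - 0"
    by (intro tendsto_minus lim_const_over_n)
  moreover have "\<exists>N. \<forall>n\<ge>N. - (K\<^sup>2 / real n) \<le> Re l"
  proof (intro exI allI impI)
    fix n assume "n \<ge> nat \<lceil>K\<rceil> + 1"
    then show "- (K\<^sup>2 / real n) \<le> Re l" by (intro lower) linarith+
  qed
  ultimately show ?thesis using LIMSEQ_le_const2 by fastforce
qed

section \<open>The geometric-Bernoulli law\<close>

lemma summable_mult_iexp_minus_1:
  fixes a x :: "nat \<Rightarrow> real"
  assumes "summable (\<lambda>j. \<bar>a j\<bar>)"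
  shows "summable (\<lambda>j. complex_of_real (a j) * (iexp (t * x j) - 1))"
proof (rule summable_norm_cancel, rule summable_comparison_test[OF _ summable_mult[OF assms, of 2]])
  have "norm (complex_of_real (a j) * (iexp (t * x j) - 1)) \<le> 2 * \<bar>a j\<bar>" for j
  proof -
    have "norm (iexp (t * x j) - 1) \<le> 2"
      using norm_triangle_ineq4[of "iexp (t * x j)" 1] by simp
    then show ?thesis
      using mult_left_mono[of "norm (iexp (t * x j) - 1)" 2 "\<bar>a j\<bar>"] by (simp add: norm_mult mult.commute)
  qed
  then show "\<exists>N. \<forall>j\<ge>N. norm (norm (complex_of_real (a j) * (iexp (t * x j) - 1))) \<le> 2 * \<bar>a j\<bar>" by simp
qed

lemma compound_poisson_root:
  fixes a x :: "nat \<Rightarrow> real"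
  assumes a: "\<And>j. a j \<ge> 0" "summable a" and n: "n \<ge> 1"
  obtains \<nu> where "real_distribution \<nu>" "\<And>t. char \<nu> t ^ n = exp (\<Sum>j. of_real (a j) * (iexp (t * x j) - 1))"
proof -
  obtain \<nu> where \<nu>: "real_distribution \<nu>" "\<And>t. char \<nu> t = exp (\<Sum>j. of_real (a j / n) * (iexp (t * x j) - 1))"
    using compound_poisson_exists[of "\<lambda>j. a j / n" x] a by (auto intro: summable_divide)
  have "char \<nu> t ^ n = exp (\<Sum>j. of_real (a j) * (iexp (t * x j) - 1))" for t
  proof -
    have "summable (\<lambda>j. \<bar>a j\<bar>)" using a by simp
    then have "(\<Sum>j. of_real (a j) * (iexp (t * x j) - 1) / of_nat n) = (\<Sum>j. of_real (a j) * (iexp (t * x j) - 1)) / of_nat n"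
      by (intro suminf_divide summable_mult_iexp_minus_1)
    moreover have "(\<Sum>j. of_real (a j / n) * (iexp (t * x j) - 1)) = (\<Sum>j. of_real (a j) * (iexp (t * x j) - 1) / of_nat n)"
      by simp
    ultimately show ?thesis
      unfolding \<nu>(2) using n by (simp add: exp_of_nat_mult[symmetric])
  qed
  then show thesis using that \<nu>(1) by blast
qed

text \<open>Dividing all masses by \<open>n\<close> gives a root of each factor, and convolving the
  two gives a root of the product. With two sequences, atoms at integers and at multiples of
  \<open>b\<close> need no common enumeration.\<close>

lemma infinitely_divisible_if_compound_poisson:
  fixes a x a' x' :: "nat \<Rightarrow> real"
  assumes \<mu>: "real_distribution \<mu>"
    and a: "\<And>j. a j \<ge> 0" "summable a" and a': "\<And>j. a' j \<ge> 0" "summable a'"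
    and char: "\<And>t. char \<mu> t = exp ((\<Sum>j. of_real (a j) * (iexp (t * x j) - 1)) + (\<Sum>j. of_real (a' j) * (iexp (t * x' j) - 1)))"
  shows "infinitely_divisible \<mu>"
  unfolding infinitely_divisible_iff_char[OF \<mu>]
proof (intro allI impI)
  fix n :: nat assume n: "n \<ge> 1"
  obtain \<nu> where \<nu>: "real_distribution \<nu>" "\<And>t. char \<nu> t ^ n = exp (\<Sum>j. of_real (a j) * (iexp (t * x j) - 1))"
    using compound_poisson_root[OF a n] by blast
  obtain \<nu>' where \<nu>': "real_distribution \<nu>'" "\<And>t. char \<nu>' t ^ n = exp (\<Sum>j. of_real (a' j) * (iexp (t * x' j) - 1))"
    using compound_poisson_root[OF a' n] by blast
  show "\<exists>\<nu>. real_distribution \<nu> \<and> (\<forall>t. char \<mu> t = char \<nu> t ^ n)"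
    by (intro exI[of _ "convolution \<nu> \<nu>'"] conjI allI real_distribution_convolution \<nu>(1) \<nu>'(1))
       (simp add: char_convolution[OF \<nu>(1) \<nu>'(1)] power_mult_distrib \<nu>(2) \<nu>'(2) char exp_add)
qed

text \<open>Taylor coefficients of \<open>log (1 + a z)\<close>; division by zero gives the correct
  constant coefficient 0.\<close>

definition log_coeff :: "real \<Rightarrow> nat \<Rightarrow> real" where
  "log_coeff a n = - ((- a) ^ n) / real n"

lemma log_coeff_0 [simp]: "log_coeff a 0 = 0"
  by (simp add: log_coeff_def)

lemma summable_abs_log_coeff:
  assumes "\<bar>a\<bar> < 1" shows "summable (\<lambda>n. \<bar>log_coeff a n\<bar>)"
proof (rule summable_comparison_test)
  show "summable (\<lambda>n. \<bar>a\<bar> ^ n)" using assms by (intro summable_geometric) simp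
  have "\<bar>log_coeff a n\<bar> \<le> \<bar>a\<bar> ^ n" for n
  proof (cases "n = 0")
    case False
    then have "\<bar>a\<bar> ^ n / real n \<le> \<bar>a\<bar> ^ n / 1" by (intro divide_left_mono) auto
    then show ?thesis by (simp add: log_coeff_def power_abs)
  qed simp
  then show "\<exists>N. \<forall>n\<ge>N. norm \<bar>log_coeff a n\<bar> \<le> \<bar>a\<bar> ^ n" by simp
qed

lemma log_coeff_sums:
  assumes "\<bar>a\<bar> < 1"
  shows "(\<lambda>n. of_real (log_coeff a n) * iexp (t * (d * real n))) sums Ln (1 + of_real a * iexp (t * d))"
proof -
  have "(\<lambda>n. - ((- (of_real a * iexp (t * d))) ^ n) / of_nat n) sums Ln (1 + of_real a * iexp (t * d))"
    by (rule Ln_series') (use assms in \<open>simp add: norm_mult\<close>)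
  also have "(\<lambda>n. - ((- (of_real a * iexp (t * d))) ^ n) / of_nat n) = (\<lambda>n. of_real (log_coeff a n) * iexp (t * (d * real n)))"
  proof
    fix n
    have "iexp (t * (d * real n)) = iexp (t * d) ^ n"
      unfolding iexp_of_nat_mult[symmetric] by (simp add: mult_ac)
    moreover have "(- (of_real a * iexp (t * d))) ^ n = (- of_real a) ^ n * iexp (t * d) ^ n"
      unfolding power_mult_distrib[symmetric] by simp
    ultimately show "- ((- (of_real a * iexp (t * d))) ^ n) / of_nat n = of_real (log_coeff a n) * iexp (t * (d * real n))"
      by (simp add: log_coeff_def)
  qed
  finally show ?thesis .
qed

text \<open>A positive real part keeps the argument off the branch cut, so the principal
  \<open>Ln\<close> is continuous along the curve.\<close>

lemma one_plus_iexp_nonzero: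
  assumes "\<bar>a\<bar> < 1" shows "Re (1 + of_real a * iexp x) > 0" "1 + of_real a * iexp x \<noteq> 0"
proof -
  have "\<bar>Re (of_real a * iexp x)\<bar> \<le> norm (of_real a * iexp x)" by (rule abs_Re_le_cmod)
  also have "\<dots> = \<bar>a\<bar>" by (simp add: norm_mult)
  finally show "Re (1 + of_real a * iexp x) > 0" using assms by simp
  then show "1 + of_real a * iexp x \<noteq> 0" by (metis less_irrefl zero_complex.simps(1))
qed

text \<open>The prefactor is \<open>p\<close> written through \<open>q\<close> and
  \<open>s = r / p\<close>: \<open>p (1 + s) = p + r = 1 - q\<close>.\<close>

locale geometric_bernoulli =
  fixes \<mu> :: "real measure" and q s b :: real
  assumes \<mu>: "real_distribution \<mu>"
    and q: "0 \<le> q" "q < 1" and s: "0 < s" "s < 1" and b: "b > 1"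
    and char_\<mu>: "\<And>t. char \<mu> t = of_real ((1 - q) / (1 + s)) * ((1 + of_real s * iexp (t * b)) / (1 - of_real q * iexp t))"
begin

text \<open>The continuous logarithm of \<open>char \<mu>\<close> that vanishes at 0; the last
  bracket is the value of the first two terms at \<open>t = 0\<close>. The form \<open>t * 1\<close>
  matches \<open>t * d\<close> in \<open>log_coeff_sums\<close>.\<close>

definition psi :: "real \<Rightarrow> complex" where
  "psi t = - Ln (1 + of_real (- q) * iexp (t * 1)) + Ln (1 + of_real s * iexp (t * b))
    - (- Ln (1 + of_real (- q)) + Ln (1 + of_real s))"

lemma char_eq_exp_psi: "char \<mu> t = exp (psi t)"
proof -
  have 1: "1 + of_real (- q) * iexp (t * 1) \<noteq> 0" "1 + of_real s * iexp (t * b) \<noteq> 0"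
    by (rule one_plus_iexp_nonzero; use q s in simp)+
  have 2: "1 + complex_of_real (- q) \<noteq> 0" "1 + complex_of_real s \<noteq> 0"
    using one_plus_iexp_nonzero(2)[of "- q" 0] one_plus_iexp_nonzero(2)[of s 0] q s by auto
  show ?thesis
    unfolding psi_def char_\<mu> exp_add exp_diff exp_minus exp_Ln[OF 1(1)] exp_Ln[OF 1(2)] exp_Ln[OF 2(1)] exp_Ln[OF 2(2)]
    by (simp add: field_simps)
qed

lemma psi_0: "psi 0 = 0"
  by (simp add: psi_def)

lemma continuous_psi: "continuous_on UNIV psi"
proof -
  have *: "\<bar>a\<bar> < 1 \<Longrightarrow> 1 + complex_of_real a * iexp x \<notin> \<real>\<^sub>\<le>\<^sub>0" for a x
    using one_plus_iexp_nonzero(1)[of a x] by (auto simp: complex_nonpos_Reals_iff)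
  show ?thesis
    unfolding psi_def[abs_def] using q s
    by (intro continuous_intros continuous_on_Ln') (auto intro!: * simp del: of_real_mult of_real_minus)
qed

lemma psi_series:
  "psi t = (\<Sum>n. of_real (- log_coeff (- q) n) * (iexp (t * real n) - 1))
    + (\<Sum>m. of_real (log_coeff s m) * (iexp (t * (b * real m)) - 1))"
proof -
  have q': "\<bar>- q\<bar> < 1" and s': "\<bar>s\<bar> < 1" using q s by auto
  have "(\<lambda>n. of_real (- log_coeff (- q) n) * (iexp (t * real n) - 1)) sums
    (- (Ln (1 + of_real (- q) * iexp (t * 1)) - Ln (1 + of_real (- q))))"
    using sums_minus[OF sums_diff[OF log_coeff_sums[OF q', of t 1] log_coeff_sums[OF q', of 0 1]]]
    by (simp add: algebra_simps)
  moreover have "(\<lambda>m. of_real (log_coeff s m) * (iexp (t * (b * real m)) - 1)) sums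
    (Ln (1 + of_real s * iexp (t * b)) - Ln (1 + of_real s))"
    using sums_diff[OF log_coeff_sums[OF s', of t b] log_coeff_sums[OF s', of 0 b]]
    by (simp add: algebra_simps)
  ultimately show ?thesis
    unfolding psi_def by (simp add: sums_iff)
qed

lemma psi_bounded: "\<exists>K. \<forall>t. norm (psi t) \<le> K"
proof -
  have bound: "norm (\<Sum>n. of_real (a n) * iexp (t * (d * real n))) \<le> (\<Sum>n. \<bar>a n\<bar>)"
    if "summable (\<lambda>n. \<bar>a n\<bar>)" for a :: "nat \<Rightarrow> real" and t d
    by (rule norm_suminf_le) (use that in \<open>auto simp: norm_mult\<close>)
  have Ln_bound: "norm (Ln (1 + of_real a * iexp (t * d))) \<le> (\<Sum>n. \<bar>log_coeff a n\<bar>)" if "\<bar>a\<bar> < 1" for a t d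
    using bound[OF summable_abs_log_coeff[OF that], of t d] sums_unique[OF log_coeff_sums[OF that, of t d]] by simp
  define \<kappa> where "\<kappa> = - Ln (1 + complex_of_real (- q)) + Ln (1 + complex_of_real s)"
  have "norm (psi t) \<le> (\<Sum>n. \<bar>log_coeff (- q) n\<bar>) + (\<Sum>n. \<bar>log_coeff s n\<bar>) + norm \<kappa>" for t
  proof -
    have "norm (psi t) \<le> norm (- Ln (1 + of_real (- q) * iexp (t * 1))) + norm (Ln (1 + of_real s * iexp (t * b))) + norm \<kappa>"
      unfolding psi_def \<kappa>_def[symmetric] by (intro norm_triangle_le_diff add_mono norm_triangle_ineq order_refl)
    then show ?thesis using Ln_bound[of "- q" t 1] Ln_bound[of s t b] q s by (simp only: norm_minus_cancel) linarith
  qed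
  then show ?thesis by blast
qed

text \<open>The atom of the (signed) Levy measure at \<open>2 b\<close> is \<open>- s\<^sup>2 / 2\<close> from the Bernoulli part, plus
  \<open>q ^ Q / Q\<close> from the geometric part if \<open>Q = 2 b\<close> is an integer.\<close>

lemma necessary:
  assumes id: "infinitely_divisible \<mu>"
  shows "\<exists>Q::nat. real Q = 2 * b \<and> q ^ Q \<ge> b * s\<^sup>2"
proof -
  have q': "\<bar>- q\<bar> < 1" and s': "\<bar>s\<bar> < 1" using q s by auto
  define x where "x = 2 * b"
  \<comment> \<open>Displacements from \<open>2 b\<close> of the integer atoms, of the atoms at
    multiples of \<open>b\<close>, and of the constant term, which sits at 0.\<close>
  define C where "C = range (\<lambda>n. real n - x) \<union> range (\<lambda>m. b * real m - x) \<union> {- x}"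
  have "countable C" by (simp add: C_def)
  then obtain h where h: "\<And>y. y \<in> C \<Longrightarrow> y \<noteq> 0 \<Longrightarrow> iexp (h * y) \<noteq> 1"
    using generic_frequency by blast
  have hx: "iexp (- (h * x)) \<noteq> 1" using h[of "- x"] b by (simp add: C_def x_def)
  have hq: "iexp (h * (real n - x)) = 1 \<longleftrightarrow> real n = x" for n using h[of "real n - x"] by (auto simp: C_def)
  have hb: "iexp (h * (b * real m - x)) = 1 \<longleftrightarrow> m = 2" for m
  proof -
    have "b * real m = x \<longleftrightarrow> m = 2" using b by (auto simp: x_def)
    then show ?thesis using h[of "b * real m - x"] by (auto simp: C_def)
  qed
  define \<kappa> where "\<kappa> = - Ln (1 + complex_of_real (- q)) + Ln (1 + complex_of_real s)"
  define \<alpha> where "\<alpha> n = complex_of_real (log_coeff (- q) n)" for n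
  define \<beta> where "\<beta> m = complex_of_real (log_coeff s m)" for m
  have sa: "summable (\<lambda>n. norm (\<alpha> n))" "summable (\<lambda>n. norm (\<beta> n))"
    using summable_abs_log_coeff q' s' by (simp_all add: \<alpha>_def \<beta>_def)
  have shift: "(\<Sum>n. of_real (log_coeff a n) * iexp (real k * (h * (d * real n - x))))
      = Ln (1 + of_real a * iexp (real k * h * d)) * iexp (real k * - (h * x))" if "\<bar>a\<bar> < 1" for a d k
  proof -
    have "iexp (real k * (h * (d * real n - x))) = iexp (real k * h * (d * real n)) * iexp (real k * - (h * x))" for n
      unfolding iexp_add[symmetric] by (simp add: algebra_simps)
    then show ?thesis
      using sums_mult2[OF log_coeff_sums[OF that, of "real k * h" d], of "iexp (real k * - (h * x))"]
      by (simp only: mult.assoc sums_iff)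
  qed
  \<comment> \<open>Only terms located exactly at \<open>x\<close> survive in the mean: at most one
    integer, and \<open>m = 2\<close>.\<close>
  define l where "l = - (\<Sum>n. \<alpha> n * of_bool (real n = x)) + (\<Sum>m. \<beta> m * of_bool (m = 2)) - \<kappa> * 0"
  have "(\<lambda>m. - ((\<Sum>k<m. \<Sum>n. \<alpha> n * iexp (real k * (h * (real n - x)))) / of_nat m)
      + (\<Sum>k<m. \<Sum>n. \<beta> n * iexp (real k * (h * (b * real n - x)))) / of_nat m
      - \<kappa> * ((\<Sum>k<m. iexp (real k * - (h * x))) / of_nat m)) \<longlonglongrightarrow> l"
    unfolding l_def
    using cesaro_mean_suminf[OF sa(1), of "\<lambda>n. h * (real n - x)"]
      cesaro_mean_suminf[OF sa(2), of "\<lambda>n. h * (b * real n - x)"] cesaro_mean_iexp[of "- (h * x)"] hx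
    unfolding hq hb by (intro tendsto_diff tendsto_add tendsto_minus tendsto_mult tendsto_const) simp_all
  also have "(\<lambda>m. - ((\<Sum>k<m. \<Sum>n. \<alpha> n * iexp (real k * (h * (real n - x)))) / of_nat m)
      + (\<Sum>k<m. \<Sum>n. \<beta> n * iexp (real k * (h * (b * real n - x)))) / of_nat m
      - \<kappa> * ((\<Sum>k<m. iexp (real k * - (h * x))) / of_nat m))
    = (\<lambda>m. (\<Sum>k<m. psi (real k * h) * iexp (real k * - (h * x))) / of_nat m)"
  proof
    fix m
    have "psi (real k * h) * iexp (real k * - (h * x))
      = - (\<Sum>n. \<alpha> n * iexp (real k * (h * (real n - x)))) + (\<Sum>n. \<beta> n * iexp (real k * (h * (b * real n - x))))
        - \<kappa> * iexp (real k * - (h * x))" for k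
      using shift[OF q', of k 1] shift[OF s', of k b]
      unfolding psi_def \<kappa>_def[symmetric] \<alpha>_def \<beta>_def mult_1_left
      by (simp only: left_diff_distrib distrib_right minus_mult_left)
    then show "- ((\<Sum>k<m. \<Sum>n. \<alpha> n * iexp (real k * (h * (real n - x)))) / of_nat m)
      + (\<Sum>k<m. \<Sum>n. \<beta> n * iexp (real k * (h * (b * real n - x)))) / of_nat m
      - \<kappa> * ((\<Sum>k<m. iexp (real k * - (h * x))) / of_nat m)
      = (\<Sum>k<m. psi (real k * h) * iexp (real k * - (h * x))) / of_nat m"
      by (simp only: sum_subtractf sum.distrib sum_negf sum_distrib_left[symmetric] diff_divide_distrib
          add_divide_distrib minus_divide_left times_divide_eq_right)
  qed
  finally have mean: "(\<lambda>m. (\<Sum>k<m. psi (real k * h) * iexp (real k * - (h * x))) / of_nat m) \<longlonglongrightarrow> l" .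
  obtain K where K: "\<And>t. norm (psi t) \<le> K" using psi_bounded by blast
  have "Re l \<ge> 0"
    by (rule infinitely_divisible_mean_nonneg[OF \<mu> id char_eq_exp_psi continuous_psi psi_0 K hx mean])
  moreover have "(\<Sum>m. \<beta> m * of_bool (m = 2)) = of_real (- (s\<^sup>2 / 2))"
    using suminf_finite[of "{2}" "\<lambda>m. \<beta> m * of_bool (m = 2)"] by (simp add: \<beta>_def log_coeff_def)
  ultimately have pos: "s\<^sup>2 / 2 \<le> - Re (\<Sum>n. \<alpha> n * of_bool (real n = x))" by (simp add: l_def)
  show ?thesis
  proof (cases "\<exists>Q::nat. real Q = x")
    case False
    \<comment> \<open>With no integer at \<open>2 b\<close> nothing offsets
      \<open>- s^2 / 2\<close>, against \<open>s > 0\<close>.\<close>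
    then have "(\<Sum>n. \<alpha> n * of_bool (real n = x)) = 0" by simp
    then show ?thesis using pos s by simp
  next
    case True
    then obtain Q :: nat where Q: "real Q = x" by blast
    have "(\<Sum>n. \<alpha> n * of_bool (real n = x)) = of_real (- (q ^ Q / x))"
      using suminf_finite[of "{Q}" "\<lambda>n. \<alpha> n * of_bool (real n = x)"] Q[symmetric] by (simp add: \<alpha>_def log_coeff_def)
    then have "s\<^sup>2 / 2 \<le> q ^ Q / x" using pos by simp
    then have "b * s\<^sup>2 \<le> q ^ Q" using b by (simp add: x_def field_simps)
    then show ?thesis using Q x_def by blast
  qed
qed

text \<open>The negative Bernoulli masses are those at even multiples \<open>2 b i = Q i\<close>;
  these are integers, so the masses merge with the geometric ones there. The odd multiples,
  collected in \<open>B\<close>, carry nonnegative mass anyway.\<close>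

lemma sufficient:
  assumes Q: "real Q = 2 * b" and ineq: "q ^ Q \<ge> b * s\<^sup>2"
  shows "infinitely_divisible \<mu>"
proof -
  have q': "\<bar>- q\<bar> < 1" and s': "\<bar>s\<bar> < 1" using q s by auto
  have Q0: "Q > 0" using Q b by (cases Q) auto
  define \<alpha> where "\<alpha> n = - log_coeff (- q) n" for n
  define \<beta> where "\<beta> = log_coeff s"
  \<comment> \<open>The mass \<open>\<beta> (2 i)\<close> moved to the integer \<open>Q i\<close>;
    at \<open>n = 0\<close> this is \<open>\<beta> 0 = 0\<close>.\<close>
  define \<gamma> where "\<gamma> n = (if Q dvd n then \<beta> (2 * (n div Q)) else 0)" for n
  define B where "B m = (if even m then 0 else \<beta> m)" for m
  have sa: "summable (\<lambda>n. \<bar>\<alpha> n\<bar>)" "summable (\<lambda>n. \<bar>\<beta> n\<bar>)"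
    using summable_abs_log_coeff q' s' by (simp_all add: \<alpha>_def \<beta>_def)
  have monoQ: "strict_mono ((*) Q)" and mono2: "strict_mono ((*) (2::nat))"
    using Q0 by (auto simp: strict_mono_def)
  have "summable (\<lambda>m. if even m then \<bar>\<beta> m\<bar> else 0)"
    by (rule summable_comparison_test[OF _ sa(2)]) auto
  moreover have "(if even m then \<bar>\<beta> m\<bar> else 0) = 0" if "m \<notin> range ((*) 2)" for m
    using that by (auto elim: evenE)
  ultimately have "summable (\<lambda>i. \<bar>\<beta> (2 * i)\<bar>)"
    using summable_mono_reindex[OF mono2, of "\<lambda>m. if even m then \<bar>\<beta> m\<bar> else 0"] by simp
  moreover have "\<bar>\<gamma> n\<bar> = 0" if "n \<notin> range ((*) Q)" for n
    using that by (auto simp: \<gamma>_def)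
  ultimately have s\<gamma>: "summable (\<lambda>n. \<bar>\<gamma> n\<bar>)"
    using summable_mono_reindex[OF monoQ, of "\<lambda>n. \<bar>\<gamma> n\<bar>"] Q0 by (simp add: \<gamma>_def)
  have sB: "summable (\<lambda>m. \<bar>B m\<bar>)"
    by (rule summable_comparison_test[OF _ sa(2)]) (auto simp: B_def)
  show ?thesis
  proof (rule infinitely_divisible_if_compound_poisson[OF \<mu>])
    show "summable (\<lambda>n. \<alpha> n + \<gamma> n)"
      by (rule summable_add[OF summable_rabs_cancel[OF sa(1)] summable_rabs_cancel[OF s\<gamma>]])
    show "summable B" using sB by (rule summable_rabs_cancel)
    show "B m \<ge> 0" for m using s by (simp add: B_def \<beta>_def log_coeff_def)
    show "\<alpha> n + \<gamma> n \<ge> 0" for n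
    proof (cases "Q dvd n \<and> n \<noteq> 0")
      case True
      then obtain i where i: "n = Q * i" "i \<noteq> 0" by auto
      \<comment> \<open>As \<open>b > 1\<close> and \<open>i \<ge> 1\<close>, the factor
        \<open>b\<close> may be enlarged to \<open>b ^ i\<close>, which makes the
        \<open>i\<close>-th power of the hypothesis applicable.\<close>
      have "b * s ^ (2 * i) \<le> b ^ i * s ^ (2 * i)"
        using b i s power_increasing[of 1 i b] by (intro mult_right_mono) auto
      also have "\<dots> = (b * s\<^sup>2) ^ i" by (simp add: power_mult_distrib power_mult)
      also have "\<dots> \<le> (q ^ Q) ^ i" using ineq b by (intro power_mono) auto
      finally have "b * s ^ (2 * i) \<le> q ^ n" by (simp add: i power_mult)
      then have "s ^ (2 * i) / real (2 * i) \<le> q ^ n / (2 * b * real i)"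
        using b i by (simp add: field_simps)
      also have "2 * b * real i = real n" using Q i by simp
      finally have "s ^ (2 * i) / real (2 * i) \<le> q ^ n / real n" .
      then show ?thesis using i Q0 by (simp add: \<alpha>_def \<gamma>_def \<beta>_def log_coeff_def)
    next
      case False
      then show ?thesis using q by (auto simp: \<alpha>_def \<gamma>_def \<beta>_def log_coeff_def)
    qed
    fix t
    define e where "e x = iexp (t * x) - 1" for x
    have sums: "summable (\<lambda>n. of_real (\<alpha> n) * e (real n))" "summable (\<lambda>n. of_real (\<gamma> n) * e (real n))"
      "summable (\<lambda>m. of_real (\<beta> m) * e (b * real m))" "summable (\<lambda>m. of_real (B m) * e (b * real m))"
      unfolding e_def by (rule summable_mult_iexp_minus_1, fact)+
    \<comment> \<open>Reindexing along \<open>n = Q i\<close> and then \<open>m = 2 i\<close>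
      identifies the merged part with the even half of the Bernoulli series;
      \<open>\<beta> - B\<close> vanishes at odd \<open>m\<close>.\<close>
    have "(\<Sum>n. of_real (\<gamma> n) * e (real n)) = (\<Sum>i. of_real (\<gamma> (Q * i)) * e (real (Q * i)))"
      by (rule suminf_mono_reindex[OF monoQ, symmetric]) (auto simp: \<gamma>_def)
    also have "\<dots> = (\<Sum>i. of_real (\<beta> (2 * i)) * e (b * real (2 * i)))"
      using Q0 Q by (simp add: \<gamma>_def mult_ac)
    also have "\<dots> = (\<Sum>i. (\<lambda>m. of_real (\<beta> m - B m) * e (b * real m)) (2 * i))"
      by (simp add: B_def)
    also have "\<dots> = (\<Sum>m. of_real (\<beta> m - B m) * e (b * real m))"
      by (rule suminf_mono_reindex[OF mono2]) (auto simp: B_def)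
    also have "\<dots> = (\<Sum>m. of_real (\<beta> m) * e (b * real m)) - (\<Sum>m. of_real (B m) * e (b * real m))"
      using suminf_diff[OF sums(3,4)] by (simp add: algebra_simps)
    finally have A: "(\<Sum>n. of_real (\<gamma> n) * e (real n))
      = (\<Sum>m. of_real (\<beta> m) * e (b * real m)) - (\<Sum>m. of_real (B m) * e (b * real m))" .
    have "(\<Sum>n. of_real (\<alpha> n + \<gamma> n) * e (real n))
      = (\<Sum>n. of_real (\<alpha> n) * e (real n)) + (\<Sum>n. of_real (\<gamma> n) * e (real n))"
      unfolding suminf_add[OF sums(1,2)] by (simp add: distrib_right)
    then have "(\<Sum>n. of_real (\<alpha> n + \<gamma> n) * e (real n)) + (\<Sum>m. of_real (B m) * e (b * real m))
      = (\<Sum>n. of_real (\<alpha> n) * e (real n)) + (\<Sum>m. of_real (\<beta> m) * e (b * real m))"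
      unfolding A by simp
    then show "char \<mu> t = exp ((\<Sum>n. of_real (\<alpha> n + \<gamma> n) * (iexp (t * real n) - 1)) + (\<Sum>m. of_real (B m) * (iexp (t * (b * real m)) - 1)))"
      unfolding char_eq_exp_psi psi_series e_def \<alpha>_def \<beta>_def by simp
  qed
qed

lemma infinitely_divisible_iff:
  "infinitely_divisible \<mu> \<longleftrightarrow> (\<exists>Q::nat. real Q = 2 * b \<and> q ^ Q \<ge> b * s\<^sup>2)"
  using necessary sufficient by blast

end

section \<open>Application to the law at the first jump\<close>

theorem theorem6p1:
  fixes M :: "'a measure" and N L :: "real \<Rightarrow> 'a \<Rightarrow> real"
    and c p q r u v w :: real and k :: int
  assumes "k < 0" and "c > 1"
    and "p \<ge> 0" and "q \<ge> 0" and "r \<ge> 0" and "p + q + r = 1"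
    and "u \<ge> 0" and "v \<ge> 0" and "w \<ge> 0"
    and "p = u / (u + v + w)" and "q = v / (u + v + w)" and "r = w / (u + v + w)"
    and "compound_poisson_process M (levy_nu c k u v w) (\<lambda>t \<omega>. (N t \<omega>, L t \<omega>))"
    and "0 < r" and "r < p"
  shows "infinitely_divisible (rho M N L) \<longleftrightarrow>
    2 * c powi \<bar>k\<bar> \<in> \<nat> - {0} \<and>
    q powr (2 * c powi \<bar>k\<bar>) \<ge> c powi \<bar>k\<bar> * (r / p)\<^sup>2"
proof -
  define b where "b = c powi \<bar>k\<bar>"
  have b: "b > 1"
    unfolding b_def power_int_def using assms(1,2) by (auto intro: one_less_power)
  have bk: "c powi (- k) = b" using assms(1) by (simp add: b_def)
  \<comment> \<open>A zero total rate would make all three quotients 0, against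
    \<open>0 < r\<close>.\<close>
  have S: "u + v + w > 0" using assms by (metis add_nonneg_nonneg div_by_0 less_eq_real_def)
  have w: "w > 0" using assms S by (simp add: zero_less_divide_iff)
  have levy: "levy_process M (\<lambda>t \<omega>. (N t \<omega>, L t \<omega>))"
    and cf0: "\<And>t z. t \<ge> 0 \<Longrightarrow> (CLINT \<omega>|M. iexp (z \<bullet> (N t \<omega>, L t \<omega>))) =
        exp (complex_of_real t * (CLINT x|levy_nu c k u v w. iexp (z \<bullet> x) - 1))"
    using assms(13) unfolding compound_poisson_process_def by blast+
  interpret prob_space M using levy unfolding levy_process_def by blast
  interpret marked_poisson M N L u v w b
  proof
    fix t x y :: real assume t: "t \<ge> 0"
    have "(CLINT z|levy_nu c k u v w. iexp ((x, y) \<bullet> z) - 1)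
      = u * (iexp x - 1) + v * (iexp y - 1) + w * (iexp (x + y * b) - 1)"
      using assms(7-9) by (subst integral_levy_nu) (simp_all add: bk)
    then show "(CLINT \<omega>|M. iexp (x * N t \<omega> + y * L t \<omega>)) =
      exp (complex_of_real t * (u * (iexp x - 1) + v * (iexp y - 1) + w * (iexp (x + y * b) - 1)))"
      using cf0[OF t, of "(x, y)"] by simp
  qed (use assms(7-9) levy w in simp_all)
  have p: "p > 0" using assms by simp
  interpret G: geometric_bernoulli "rho M N L" q "r / p" b
  proof (rule geometric_bernoulli.intro)
    fix t
    define R where "R = u + v + w"
    have eqs: "p * R = u" "q * R = v" "r * R = w" and R: "R > 0"
      using assms(10-12) S by (simp_all add: R_def)
    have "of_real R * (p + r * iexp (t * b)) = of_real (p * R) + of_real (r * R) * iexp (t * b)"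
      by (simp add: algebra_simps)
    then have num: "of_real R * (p + r * iexp (t * b)) = u + w * iexp (t * b)"
      unfolding eqs .
    have "of_real R * (1 - q * iexp t) = of_real R - of_real (q * R) * iexp t"
      by (simp add: algebra_simps)
    then have den: "of_real R * (1 - q * iexp t) = of_real R - v * iexp t"
      unfolding eqs .
    have "char (rho M N L) t = (u + w * iexp (t * b)) / (u + v + w - v * iexp t)"
      by (rule rho_characteristic_function)
    also have "\<dots> = (of_real R * (p + r * iexp (t * b))) / (of_real R * (1 - q * iexp t))"
      unfolding num den by (simp add: R_def)
    also have "\<dots> = (p + r * iexp (t * b)) / (1 - q * iexp t)"
      using R by (intro mult_divide_mult_cancel_left) simp
    also have "p + r * iexp (t * b) = p * (1 + of_real (r / p) * iexp (t * b))"
      using p by (simp add: field_simps)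
    also have "complex_of_real p = of_real ((1 - q) / (1 + r / p))"
    proof -
      have "1 - q = p + r" using assms(6) by simp
      then have "1 - q = p * (1 + r / p)" using p by (simp add: distrib_left)
      moreover have "1 + r / p > 0" using p assms by (simp add: add_pos_nonneg)
      ultimately show ?thesis by simp
    qed
    finally show "char (rho M N L) t = of_real ((1 - q) / (1 + r / p)) *
        ((1 + of_real (r / p) * iexp (t * b)) / (1 - of_real q * iexp t))"
      by simp
    show "0 \<le> q" "q < 1" "0 < r / p" "r / p < 1" "b > 1"
      using assms(3-6,14,15) p b by (simp_all add: divide_less_eq)
  qed (rule rho_characteristic_function(1))
  have "infinitely_divisible (rho M N L) \<longleftrightarrow> (\<exists>Q::nat. real Q = 2 * b \<and> q ^ Q \<ge> b * (r / p)\<^sup>2)"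
    by (rule G.infinitely_divisible_iff)
  also have "\<dots> \<longleftrightarrow> 2 * b \<in> \<nat> - {0} \<and> q powr (2 * b) \<ge> b * (r / p)\<^sup>2"
  proof -
    \<comment> \<open>For \<open>q = 0\<close> both powers are 0, since the exponent
      \<open>2 b\<close> is positive.\<close>
    have powr: "q powr (2 * b) = q ^ Q" if "real Q = 2 * b" for Q
      using that b assms(4) powr_realpow[of q Q] by (cases "q = 0") auto
    have "2 * b \<in> \<nat> - {0} \<longleftrightarrow> (\<exists>Q::nat. real Q = 2 * b)"
      using b by (metis Diff_iff Nats_cases of_nat_in_Nats singletonD less_irrefl less_trans
          mult_pos_pos zero_less_numeral zero_less_one)
    then show ?thesis using powr by metis
  qed
  finally show ?thesis unfolding b_def .
qed

end
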